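(* Let $p\ge0$, $C_A\ge1$, $C_\kappa\ge0$, $C_2\ge1$. There is a constant $C>0$, depending only on $p$, $C_A$, $C_\kappa$ and $C_2$, such that the following holds. Assume $D\ge3$, $\delta>0$, $C_A^{-1}i^{-p}\le\lambda_i\le C_Ai^{-p}$ for $1\le i\le D$, $|\kappa-D\delta^2|\le C_\kappa\sqrt D\,\delta^2$, and set $m_0=\lfloor128\log(D)\sqrt D\rfloor+1$, where $m_0\le D$. Suppose the model selector $\widehat m\in\{0,\ldots,m_0\}$, chosen on the basis of $\widehat\mu^{(0)},\ldots,\widehat\mu^{(m_0)}$, satisfies for any signal $\mu\in\mathbb{R}^D$ $$\mathbb{E}[\|\widehat\mu^{(\widehat m)}-\mu\|^2]\le C_2\Big(\min_{m\in\{0,\ldots,m_0\}}\mathbb{E}[\|\widehat\mu^{(m)}-\mu\|^2]+\delta^2\Big).$$ Then, uniformly over all signals $\mu\in\mathbb{R}^D$, the estimator $$\widehat\mu^{(\rho)}=\begin{cases}\widehat\mu^{(\widehat m)},&\text{if }\tau=m_0,\\ \widehat\mu^{(\tau)},&\text{if }\tau>m_0\end{cases}$$ satisfies $$\mathbb{E}\big[\|\widehat\mu^{(\rho)}-\mu\|^2\big]\le C\Big(\min_{m\in\{0,\ldots,D\}}\mathbb{E}\big[\|\widehat\mu^{(m)}-\mu\|^2\big]+\delta^2\Big).$$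
   Context: Model: $\lambda_1\ge\cdots\ge\lambda_D>0$ are known, and for a signal $\mu\in\mathbb{R}^D$ one observes $Y_i=\lambda_i\mu_i+\delta\varepsilon_i$, $i=1,\ldots,D$, with $\varepsilon_i$ independent $N(0,1)$; $\mathbb{E}$ is expectation under signal $\mu$; $\|\cdot\|$ is the Euclidean norm. Truncated SVD estimators: $\widehat\mu^{(m)}_i=\mathbf 1(i\le m)\lambda_i^{-1}Y_i$, $0\le m\le D$. Residuals: $R_m^2=\sum_{i=m+1}^DY_i^2$. Given the starting index $m_0$ and threshold $\kappa>0$, the stopping rule is $\tau=\min\{m\in\{m_0,\ldots,D\}:R_m^2\le\kappa\}$. The model selector $\widehat m$ is a measurable function of $(\widehat\mu^{(0)},\ldots,\widehat\mu^{(m_0)})$, i.e. of $(Y_1,\ldots,Y_{m_0})$. *)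

theory Defs
  imports "HOL-Probability.Probability"
begin

text \<open>
  Vectors in \<open>\<real>\<^sup>D\<close> are functions \<open>nat \<Rightarrow> real\<close> of which only the coordinates in \<open>{1..D}\<close>
  matter. The noise vector lives on its canonical probability space, the \<open>D\<close>-fold product of
  \<open>N(0,1)\<close>; nothing is lost, as all random quantities below are functions of the observations.
\<close>

definition noise :: "nat \<Rightarrow> (nat \<Rightarrow> real) measure" where
  "noise D = (\<Pi>\<^sub>M i\<in>{1..D}. std_normal_distribution)"

definition obs :: "(nat \<Rightarrow> real) \<Rightarrow> real \<Rightarrow> (nat \<Rightarrow> real) \<Rightarrow> (nat \<Rightarrow> real) \<Rightarrow> nat \<Rightarrow> real" where
  "obs lam \<delta> \<mu> \<epsilon> i = lam i * \<mu> i + \<delta> * \<epsilon> i"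

text \<open>
  An estimator is a function from the observation vector to \<open>\<real>\<^sup>D\<close>. The squared losses of all
  estimators considered here are integrable, so the Bochner integral is the true expectation.
\<close>

definition risk ::
  "nat \<Rightarrow> (nat \<Rightarrow> real) \<Rightarrow> real \<Rightarrow> ((nat \<Rightarrow> real) \<Rightarrow> nat \<Rightarrow> real) \<Rightarrow> (nat \<Rightarrow> real) \<Rightarrow> real" where
  "risk D lam \<delta> est \<mu> =
     (\<integral>\<epsilon>. (L2_set (\<lambda>i. est (obs lam \<delta> \<mu> \<epsilon>) i - \<mu> i) {1..D})\<^sup>2 \<partial>noise D)"

definition tsvd :: "(nat \<Rightarrow> real) \<Rightarrow> nat \<Rightarrow> (nat \<Rightarrow> real) \<Rightarrow> nat \<Rightarrow> real" where
  "tsvd lam m y i = (if i \<le> m then inverse (lam i) * y i else 0)"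

definition residual :: "nat \<Rightarrow> nat \<Rightarrow> (nat \<Rightarrow> real) \<Rightarrow> real" where
  "residual D m y = (\<Sum>i = m + 1..D. (y i)\<^sup>2)"

text \<open>
  For \<open>m\<^sub>0 \<le> D\<close> and \<open>\<kappa> \<ge> 0\<close> the set below contains \<open>D\<close>, so the minimum is attained.
\<close>

definition stop_index :: "nat \<Rightarrow> nat \<Rightarrow> real \<Rightarrow> (nat \<Rightarrow> real) \<Rightarrow> nat" where
  "stop_index D m0 \<kappa> y = Min {m \<in> {m0..D}. residual D m y \<le> \<kappa>}"

definition start_index :: "nat \<Rightarrow> nat" where
  "start_index D = nat \<lfloor>128 * ln (real D) * sqrt (real D)\<rfloor> + 1"

text \<open>
  A selector only sees \<open>(Y\<^sub>1, \<dots>, Y\<^sub>m\<^sub>0)\<close>, which carries the same information as the first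
  \<open>m\<^sub>0 + 1\<close> truncated SVD estimators because every \<open>lam i\<close> is a known positive number.
\<close>

definition selectors :: "nat \<Rightarrow> ((nat \<Rightarrow> real) \<Rightarrow> nat) set" where
  "selectors m0 = (\<Pi>\<^sub>M i\<in>{1..m0}. borel) \<rightarrow>\<^sub>M count_space {0..m0}"

definition selected_est ::
  "(nat \<Rightarrow> real) \<Rightarrow> nat \<Rightarrow> ((nat \<Rightarrow> real) \<Rightarrow> nat) \<Rightarrow> (nat \<Rightarrow> real) \<Rightarrow> nat \<Rightarrow> real" where
  "selected_est lam m0 sel y = tsvd lam (sel (restrict y {1..m0})) y"

definition two_step_est ::
  "nat \<Rightarrow> (nat \<Rightarrow> real) \<Rightarrow> nat \<Rightarrow> real \<Rightarrow> ((nat \<Rightarrow> real) \<Rightarrow> nat) \<Rightarrow> (nat \<Rightarrow> real) \<Rightarrow> nat \<Rightarrow> real" where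
  "two_step_est D lam m0 \<kappa> sel y =
     (if stop_index D m0 \<kappa> y = m0 then selected_est lam m0 sel y
      else tsvd lam (stop_index D m0 \<kappa> y) y)"

end

theory Submission
  imports Defs
begin

text \<open>
  Write \<open>B m\<close> for the squared bias \<open>\<Sum>i>m. (\<mu> i)\<^sup>2\<close>, \<open>b m\<close> for the weak bias
  \<open>\<Sum>i>m. (lam i * \<mu> i)\<^sup>2\<close>, \<open>V m\<close> for the variance \<open>\<Sum>i\<le>m. (\<delta> / lam i)\<^sup>2\<close>, \<open>R m\<close> for
  the residual and \<open>\<tau>\<close> for the stopping index. The truncated estimator at \<open>m\<close> has risk
  \<open>V m + B m\<close>; let \<open>M\<close> minimise it. The residual \<open>R m\<close> has mean \<open>b m + (D - m) * \<delta>\<^sup>2\<close> and is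
  compared with \<open>\<kappa>\<close>, which is \<open>D * \<delta>\<^sup>2\<close> up to the order \<open>sqrt D * \<delta>\<^sup>2\<close>. Hence stopping is
  expected once \<open>b m\<close> falls to the order of \<open>m * \<delta>\<^sup>2\<close>, and the fluctuations of the residual are
  dominated by this drift because all indices are at least \<open>m0 \<ge> 128 * ln D * sqrt D\<close>.

  The loss of the two-step estimator is \<open>B \<tau>\<close> plus the loss inside the retained coordinates
  (\<open>two_step_loss_le\<close>), and three effects have to be compared with \<open>V M + B M + \<delta>\<^sup>2\<close>.

  Selection. If \<open>\<tau> = m0\<close>, the loss on the first \<open>m0\<close> coordinates equals the full loss of the
  selected estimator for the signal truncated at \<open>m0\<close>, since the selector sees the same data. The
  hypothesis on the selector, used for this truncated signal, bounds its expectation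
  (\<open>selected_risk_truncated\<close>), and this decouples selection from stopping.

  Stopping too early. By monotonicity of the residuals, \<open>B \<tau> - B M\<close> is at most
  \<open>(\<Sum>m0\<le>m<M. (b m - b (m + 1)) * of_bool (R m \<le> \<kappa>)) / (lam M)\<^sup>2\<close>. An exponential Markov
  inequality at the rate \<open>1 / (M * \<delta>\<^sup>2)\<close> shows that the event has probability at most a constant
  times \<open>exp (- b m / (2 * M * \<delta>\<^sup>2))\<close>. The sum then telescopes to the order of \<open>M * \<delta>\<^sup>2\<close>, and
  \<open>M * (\<delta> / lam M)\<^sup>2\<close> is of the order of \<open>V M\<close> as \<open>lam\<close> decays polynomially
  (\<open>early_stop_strong_bias\<close>).

  Stopping too late. Let \<open>n\<close> be the first index from \<open>m0\<close> on with \<open>b n \<le> n * \<delta>\<^sup>2 / 4\<close>. The noise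
  up to \<open>n\<close> costs \<open>V n\<close>; if \<open>n > m0\<close>, then \<open>b (n - 1)\<close> is large, hence so is \<open>B (n - 1)\<close>, and
  \<open>V n \<le> 8 * (V M + B M)\<close> follows whichever of \<open>n\<close> and \<open>M\<close> is larger (\<open>unstable_variance_le\<close>).
  Going beyond \<open>n\<close> requires \<open>R n > \<kappa>\<close>, an upward deviation of the order of \<open>ln D\<close> times
  \<open>sqrt D * \<delta>\<^sup>2\<close> at least. Its probability is at most \<open>exp (c * ln D - 60 * (ln D)\<^sup>2)\<close>, which outweighs
  the polynomial size of \<open>V D / \<delta>\<^sup>2\<close> (\<open>late_stop_energy\<close>).
\<close>

section \<open>Bias, variance and noise energy\<close>

text \<open>
  For \<open>a = \<mu>\<close> this is the squared bias of the truncated estimator at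
  \<open>m\<close> (the strong bias); for \<open>a i = lam i * \<mu> i\<close> it is the bias on
  the observation scale (the weak bias), the signal part of the mean of the residual.
\<close>
definition sq_bias :: "nat \<Rightarrow> (nat \<Rightarrow> real) \<Rightarrow> nat \<Rightarrow> real" where
  "sq_bias D a m = (\<Sum>i = m + 1..D. (a i)\<^sup>2)"

definition variance_upto :: "(nat \<Rightarrow> real) \<Rightarrow> real \<Rightarrow> nat \<Rightarrow> real" where
  "variance_upto lam \<delta> m = (\<Sum>i = 1..m. (\<delta> / lam i)\<^sup>2)"

text \<open>
  The stochastic part of the squared loss of the truncated estimator at \<open>m\<close>.
\<close>
definition noise_energy :: "(nat \<Rightarrow> real) \<Rightarrow> real \<Rightarrow> (nat \<Rightarrow> real) \<Rightarrow> nat \<Rightarrow> real" where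
  "noise_energy lam \<delta> \<epsilon> m = (\<Sum>i = 1..m. (\<delta> / lam i)\<^sup>2 * (\<epsilon> i)\<^sup>2)"

definition truncated :: "nat \<Rightarrow> (nat \<Rightarrow> real) \<Rightarrow> nat \<Rightarrow> real" where
  "truncated m \<mu> i = (if i \<le> m then \<mu> i else 0)"

lemma sq_bias_nonneg: "0 \<le> sq_bias D a m"
  unfolding sq_bias_def by (intro sum_nonneg) auto

lemma sq_bias_antimono: "k \<le> m \<Longrightarrow> sq_bias D a m \<le> sq_bias D a k"
  unfolding sq_bias_def by (intro sum_mono2) auto

lemma sq_bias_split:
  assumes "k \<le> m" "m \<le> D"
  shows "sq_bias D a k = (\<Sum>i = k + 1..m. (a i)\<^sup>2) + sq_bias D a m"
  unfolding sq_bias_def using assms sum.ub_add_nat[of "k+1" m "\<lambda>i. (a i)\<^sup>2" "D - m"] by simp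

lemma sq_bias_step: "m < D \<Longrightarrow> sq_bias D a m - sq_bias D a (Suc m) = (a (Suc m))\<^sup>2"
  using sq_bias_split[of m "Suc m" D a] by simp

lemma sq_bias_truncated:
  assumes "k \<le> m" "m \<le> D"
  shows "sq_bias D \<mu> k = sq_bias D (truncated m \<mu>) k + sq_bias D \<mu> m"
proof -
  have "sq_bias D (truncated m \<mu>) m = 0"
    unfolding sq_bias_def truncated_def by (intro sum.neutral) auto
  moreover have "(\<Sum>i = k + 1..m. (truncated m \<mu> i)\<^sup>2) = (\<Sum>i = k + 1..m. (\<mu> i)\<^sup>2)"
    by (intro sum.cong) (auto simp: truncated_def)
  ultimately show ?thesis
    using sq_bias_split[OF assms, of "truncated m \<mu>"] sq_bias_split[OF assms, of \<mu>] by simp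
qed

lemma variance_upto_nonneg: "0 \<le> variance_upto lam \<delta> m"
  unfolding variance_upto_def by (intro sum_nonneg) auto

lemma variance_upto_mono: "k \<le> m \<Longrightarrow> variance_upto lam \<delta> k \<le> variance_upto lam \<delta> m"
  unfolding variance_upto_def by (intro sum_mono2) auto

lemma noise_energy_nonneg: "0 \<le> noise_energy lam \<delta> \<epsilon> m"
  unfolding noise_energy_def by (intro sum_nonneg) auto

lemma noise_energy_mono: "k \<le> m \<Longrightarrow> noise_energy lam \<delta> \<epsilon> k \<le> noise_energy lam \<delta> \<epsilon> m"
  unfolding noise_energy_def by (intro sum_mono2) auto

section \<open>Moments of the noise\<close>

lemma prob_space_noise: "prob_space (noise D)"
  unfolding noise_def
  by (intro prob_space_PiM prob_space_normal_density) simp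

lemma noise_coordinate:
  assumes "i \<in> {1..D}" and f: "integrable std_normal_distribution (f :: real \<Rightarrow> real)"
  shows "integrable (noise D) (\<lambda>\<epsilon>. f (\<epsilon> i))"
    and "(\<integral>\<epsilon>. f (\<epsilon> i) \<partial>noise D) = (\<integral>x. f x \<partial>std_normal_distribution)"
proof -
  have "prob_space std_normal_distribution" by (rule prob_space_normal_density) simp
  then have d: "distr (noise D) std_normal_distribution (\<lambda>\<epsilon>. \<epsilon> i) = std_normal_distribution"
    unfolding noise_def using assms(1) by (intro distr_PiM_component) auto
  have m: "(\<lambda>\<epsilon>. \<epsilon> i) \<in> measurable (noise D) std_normal_distribution"
    unfolding noise_def using assms(1) by (rule measurable_component_singleton)
  show "integrable (noise D) (\<lambda>\<epsilon>. f (\<epsilon> i))"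
    using integrable_distr[OF m] f d by simp
  show "(\<integral>\<epsilon>. f (\<epsilon> i) \<partial>noise D) = (\<integral>x. f x \<partial>std_normal_distribution)"
    using integral_distr[OF m, of f] borel_measurable_integrable[OF f] d by simp
qed

lemma noise_even_moment:
  assumes "i \<in> {1..D}"
  shows "integrable (noise D) (\<lambda>\<epsilon>. (\<epsilon> i) ^ (2 * k))"
    and "(\<integral>\<epsilon>. (\<epsilon> i) ^ (2 * k) \<partial>noise D) = fact (2 * k) / (2 ^ k * fact k)"
proof -
  have h: "has_bochner_integral lborel (\<lambda>x. std_normal_density x *\<^sub>R (x::real) ^ (2 * k))
      (fact (2 * k) / (2 ^ k * fact k))"
    using std_normal_moment_even[of k] by simp
  have i: "integrable std_normal_distribution (\<lambda>x::real. x ^ (2 * k))"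
    using h by (subst integrable_density) (auto simp: has_bochner_integral_iff)
  have v: "(\<integral>x. x ^ (2 * k) \<partial>std_normal_distribution) = fact (2 * k) / (2 ^ k * fact k)"
    using h by (subst integral_density) (auto simp: has_bochner_integral_iff)
  show "integrable (noise D) (\<lambda>\<epsilon>. (\<epsilon> i) ^ (2 * k))" by (rule noise_coordinate(1)[OF assms i])
  show "(\<integral>\<epsilon>. (\<epsilon> i) ^ (2 * k) \<partial>noise D) = fact (2 * k) / (2 ^ k * fact k)"
    using noise_coordinate(2)[OF assms i] v by simp
qed

lemma noise_second_moment:
  assumes "i \<in> {1..D}"
  shows "integrable (noise D) (\<lambda>\<epsilon>. (\<epsilon> i)\<^sup>2)" "(\<integral>\<epsilon>. (\<epsilon> i)\<^sup>2 \<partial>noise D) = 1"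
  using noise_even_moment[OF assms, of 1] by simp_all

lemma noise_fourth_moment:
  assumes "i \<in> {1..D}"
  shows "integrable (noise D) (\<lambda>\<epsilon>. (\<epsilon> i)^4)" "(\<integral>\<epsilon>. (\<epsilon> i)^4 \<partial>noise D) = 3"
  using noise_even_moment[OF assms, of 2] by (simp_all add: fact_numeral)

lemma noise_energy_expectation:
  assumes "m \<le> D"
  shows "integrable (noise D) (\<lambda>\<epsilon>. noise_energy lam \<delta> \<epsilon> m)"
    and "(\<integral>\<epsilon>. noise_energy lam \<delta> \<epsilon> m \<partial>noise D) = variance_upto lam \<delta> m"
proof -
  have i: "integrable (noise D) (\<lambda>\<epsilon>. (\<delta> / lam i)\<^sup>2 * (\<epsilon> i)\<^sup>2)" if "i \<in> {1..m}" for i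
    using that assms by (intro integrable_mult_right noise_second_moment) auto
  show "integrable (noise D) (\<lambda>\<epsilon>. noise_energy lam \<delta> \<epsilon> m)"
    unfolding noise_energy_def using i by (intro Bochner_Integration.integrable_sum)
  have "(\<integral>\<epsilon>. noise_energy lam \<delta> \<epsilon> m \<partial>noise D)
      = (\<Sum>i = 1..m. \<integral>\<epsilon>. (\<delta> / lam i)\<^sup>2 * (\<epsilon> i)\<^sup>2 \<partial>noise D)"
    unfolding noise_energy_def using i by (intro Bochner_Integration.integral_sum)
  also have "\<dots> = variance_upto lam \<delta> m"
    unfolding variance_upto_def using assms
    by (intro sum.cong refl) (simp add: noise_second_moment)
  finally show "(\<integral>\<epsilon>. noise_energy lam \<delta> \<epsilon> m \<partial>noise D) = variance_upto lam \<delta> m" .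
qed

section \<open>Exponential moments of the residual\<close>

text \<open>
  The noncentral chi-square moment generating function with one degree of freedom, on the whole
  range of \<open>s\<close> where it is finite. Negative \<open>s\<close> will control lower
  deviations of the residual, positive \<open>s\<close> upper ones.
\<close>
lemma std_normal_exp_square:
  fixes a s :: real
  assumes "s < 1 / 2"
  shows "integrable std_normal_distribution (\<lambda>x. exp (s * (a + x)\<^sup>2))"
    and "(\<integral>x. exp (s * (a + x)\<^sup>2) \<partial>std_normal_distribution)
         = exp (s / (1 - 2 * s) * a\<^sup>2) / sqrt (1 - 2 * s)"
proof -
  define v where "v = 1 - 2 * s"
  have v: "v > 0" "s = (1 - v) / 2" using assms by (auto simp: v_def)
  define c where "c = exp (s / v * a\<^sup>2) / sqrt v"
  \<comment> \<open>Completing the square: the integrand is a constant times the density of N(2s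
    a/v, 1/v).\<close>
  have eq: "std_normal_density x * exp (s * (a + x)\<^sup>2)
      = c * normal_density (2 * s * a / v) (1 / sqrt v) x" for x
  proof -
    have "- x\<^sup>2 / 2 + s * (a + x)\<^sup>2 = s / v * a\<^sup>2 - (x - 2 * s * a / v)\<^sup>2 / (2 * (1 / sqrt v)\<^sup>2)"
      using v(1) unfolding v(2) by (simp add: power2_eq_square field_simps)
    then have "exp (- x\<^sup>2 / 2) * exp (s * (a + x)\<^sup>2)
        = exp (s / v * a\<^sup>2) * exp (- (x - 2 * s * a / v)\<^sup>2 / (2 * (1 / sqrt v)\<^sup>2))"
      unfolding exp_add[symmetric] by simp
    moreover have "1 / sqrt (2 * pi * (1 / sqrt v)\<^sup>2) = sqrt v / sqrt (2 * pi)"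
      using v(1) by (simp add: power_divide real_sqrt_divide)
    ultimately show ?thesis
      using v(1) by (simp add: c_def normal_density_def field_simps)
  qed
  have n: "integrable lborel (normal_density (2 * s * a / v) (1 / sqrt v))"
    "(\<integral>x. normal_density (2 * s * a / v) (1 / sqrt v) x \<partial>lborel) = 1"
    using v(1) by simp_all
  show "integrable std_normal_distribution (\<lambda>x. exp (s * (a + x)\<^sup>2))"
    using n(1) by (subst integrable_density) (auto simp: eq)
  show "(\<integral>x. exp (s * (a + x)\<^sup>2) \<partial>std_normal_distribution)
         = exp (s / (1 - 2 * s) * a\<^sup>2) / sqrt (1 - 2 * s)"
    using n(2) by (subst integral_density) (auto simp: eq c_def v_def)
qed

lemma residual_exp_moment:
  assumes "\<delta> > 0" "s < 1 / 2"
  shows "integrable (noise D) (\<lambda>\<epsilon>. exp (s * (residual D m (obs lam \<delta> \<mu> \<epsilon>) / \<delta>\<^sup>2)))"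
    and "(\<integral>\<epsilon>. exp (s * (residual D m (obs lam \<delta> \<mu> \<epsilon>) / \<delta>\<^sup>2)) \<partial>noise D)
         = exp (s / (1 - 2 * s) * (sq_bias D (\<lambda>i. lam i * \<mu> i) m / \<delta>\<^sup>2)) / sqrt (1 - 2 * s) ^ (D - m)"
proof -
  interpret std: prob_space std_normal_distribution by (rule prob_space_normal_density) simp
  interpret product_prob_space "\<lambda>_::nat. std_normal_distribution" "{1..D}" by unfold_locales
  \<comment> \<open>A product over all coordinates, those up to \<open>m\<close> with the factor
    1, so that it factorises over the product measure.\<close>
  define f where "f i x = (if i \<in> {m + 1..D} then exp (s * (lam i * \<mu> i / \<delta> + x)\<^sup>2) else 1)"
    for i and x :: real
  have int: "integrable std_normal_distribution (f i)" for i
    unfolding f_def using std_normal_exp_square(1)[OF assms(2)] by (cases "i \<in> {m + 1..D}") auto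
  have val: "integral\<^sup>L std_normal_distribution (f i) = (if i \<in> {m + 1..D}
      then exp (s / (1 - 2 * s) * (lam i * \<mu> i / \<delta>)\<^sup>2) / sqrt (1 - 2 * s) else 1)" for i
  proof (cases "i \<in> {m + 1..D}")
    case True
    then have "f i = (\<lambda>x. exp (s * (lam i * \<mu> i / \<delta> + x)\<^sup>2))" by (auto simp: f_def)
    with True show ?thesis using std_normal_exp_square(2)[OF assms(2)] by simp
  next
    case False
    then have "f i = (\<lambda>x. 1)" unfolding f_def by (simp only: if_False)
    with False show ?thesis using std.prob_space by (simp only: if_False) simp
  qed
  have eq: "exp (s * (residual D m (obs lam \<delta> \<mu> \<epsilon>) / \<delta>\<^sup>2)) = (\<Prod>i\<in>{1..D}. f i (\<epsilon> i))" for \<epsilon>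
  proof -
    have "s * (residual D m (obs lam \<delta> \<mu> \<epsilon>) / \<delta>\<^sup>2)
        = (\<Sum>i = m + 1..D. s * (lam i * \<mu> i / \<delta> + \<epsilon> i)\<^sup>2)"
      unfolding residual_def obs_def sum_divide_distrib sum_distrib_left
      using assms(1) by (intro sum.cong refl) (simp add: power2_eq_square field_simps)
    then have "exp (s * (residual D m (obs lam \<delta> \<mu> \<epsilon>) / \<delta>\<^sup>2))
        = (\<Prod>i = m + 1..D. exp (s * (lam i * \<mu> i / \<delta> + \<epsilon> i)\<^sup>2))"
      by (simp add: exp_sum)
    also have "\<dots> = (\<Prod>i\<in>{1..D}. f i (\<epsilon> i))"
      by (intro prod.mono_neutral_cong_left) (auto simp: f_def)
    finally show ?thesis .
  qed
  show "integrable (noise D) (\<lambda>\<epsilon>. exp (s * (residual D m (obs lam \<delta> \<mu> \<epsilon>) / \<delta>\<^sup>2)))"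
    unfolding eq noise_def using int by (intro product_integrable_prod) auto
  have "(\<integral>\<epsilon>. exp (s * (residual D m (obs lam \<delta> \<mu> \<epsilon>) / \<delta>\<^sup>2)) \<partial>noise D)
      = (\<Prod>i\<in>{1..D}. integral\<^sup>L std_normal_distribution (f i))"
    unfolding eq noise_def using int by (intro product_integral_prod) auto
  also have "\<dots> = (\<Prod>i = m + 1..D. exp (s / (1 - 2 * s) * (lam i * \<mu> i / \<delta>)\<^sup>2) / sqrt (1 - 2 * s))"
    using val by (intro prod.mono_neutral_cong_right) auto
  also have "\<dots> = exp (\<Sum>i = m + 1..D. s / (1 - 2 * s) * (lam i * \<mu> i / \<delta>)\<^sup>2) / sqrt (1 - 2 * s) ^ (D - m)"
    by (simp add: prod_dividef exp_sum)
  also have "(\<Sum>i = m + 1..D. s / (1 - 2 * s) * (lam i * \<mu> i / \<delta>)\<^sup>2)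
      = s / (1 - 2 * s) * (sq_bias D (\<lambda>i. lam i * \<mu> i) m / \<delta>\<^sup>2)"
    unfolding sq_bias_def sum_divide_distrib sum_distrib_left
    by (intro sum.cong refl) (simp add: power_divide)
  finally show "(\<integral>\<epsilon>. exp (s * (residual D m (obs lam \<delta> \<mu> \<epsilon>) / \<delta>\<^sup>2)) \<partial>noise D)
         = exp (s / (1 - 2 * s) * (sq_bias D (\<lambda>i. lam i * \<mu> i) m / \<delta>\<^sup>2)) / sqrt (1 - 2 * s) ^ (D - m)" .
qed

text \<open>
  The normalising factor is estimated by the second-order expansion of the logarithm: up to a
  quadratic error each pure-noise coordinate contributes its mean \<open>s\<close> to the
  exponent. The signal term is kept exact because its two useful bounds depend on the sign of
  \<open>s\<close>.
\<close>
lemma residual_exp_moment_le: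
  assumes "\<delta> > 0" "\<bar>s\<bar> \<le> 1 / 4"
  shows "(\<integral>\<epsilon>. exp (s * (residual D m (obs lam \<delta> \<mu> \<epsilon>) / \<delta>\<^sup>2)) \<partial>noise D)
         \<le> exp (real (D - m) * (s + 4 * s\<^sup>2) + s / (1 - 2 * s) * (sq_bias D (\<lambda>i. lam i * \<mu> i) m / \<delta>\<^sup>2))"
proof -
  have s: "s < 1 / 2" "1 - 2 * s > 0" using assms(2) by auto
  have "\<bar>ln (1 + (- 2 * s)) - (- 2 * s)\<bar> \<le> 2 * (- 2 * s)\<^sup>2"
    using assms(2) by (intro abs_ln_one_plus_x_minus_x_bound) auto
  then have "- ln (1 - 2 * s) / 2 \<le> s + 4 * s\<^sup>2" by (simp add: abs_le_iff)
  then have "exp (- ln (1 - 2 * s) / 2) \<le> exp (s + 4 * s\<^sup>2)" by simp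
  moreover have "exp (- ln (1 - 2 * s) / 2) = 1 / sqrt (1 - 2 * s)"
    using s(2) by (simp add: exp_minus ln_sqrt[symmetric] field_simps)
  ultimately have "1 / sqrt (1 - 2 * s) \<le> exp (s + 4 * s\<^sup>2)" by (simp only:)
  then have "(1 / sqrt (1 - 2 * s)) ^ (D - m) \<le> exp (s + 4 * s\<^sup>2) ^ (D - m)"
    using s(2) by (intro power_mono) auto
  also have "\<dots> = exp (real (D - m) * (s + 4 * s\<^sup>2))" by (simp add: exp_of_nat_mult)
  finally show ?thesis
    unfolding residual_exp_moment(2)[OF assms(1) s(1)] exp_add
    by (simp add: power_inverse mult_right_mono divide_inverse mult.commute)
qed

section \<open>Losses of the truncated and of the selected estimators\<close>

lemma tsvd_loss:
  assumes "m \<le> D" "\<forall>i\<in>{1..D}. lam i > 0"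
  shows "(L2_set (\<lambda>i. tsvd lam m (obs lam \<delta> \<mu> \<epsilon>) i - \<mu> i) {1..D})\<^sup>2
    = noise_energy lam \<delta> \<epsilon> m + sq_bias D \<mu> m"
proof -
  define f where "f i = tsvd lam m (obs lam \<delta> \<mu> \<epsilon>) i - \<mu> i" for i
  have "(L2_set f {1..D})\<^sup>2 = sq_bias D f 0"
    by (simp add: L2_set_def sq_bias_def sum_nonneg)
  also have "\<dots> = (\<Sum>i = 1..m. (f i)\<^sup>2) + sq_bias D f m"
    using sq_bias_split[of 0 m D f] assms(1) by simp
  also have "(\<Sum>i = 1..m. (f i)\<^sup>2) = noise_energy lam \<delta> \<epsilon> m"
    unfolding noise_energy_def
  proof (intro sum.cong refl)
    fix i assume "i \<in> {1..m}"
    then have "i \<le> m" "lam i > 0" using assms by auto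
    then have "f i = \<delta> / lam i * \<epsilon> i" by (simp add: f_def tsvd_def obs_def field_simps)
    then show "(f i)\<^sup>2 = (\<delta> / lam i)\<^sup>2 * (\<epsilon> i)\<^sup>2" by (simp add: power_mult_distrib power_divide)
  qed
  also have "sq_bias D f m = sq_bias D \<mu> m"
    unfolding sq_bias_def by (intro sum.cong) (auto simp: f_def tsvd_def)
  finally show ?thesis by (simp add: f_def[abs_def])
qed

lemma risk_tsvd:
  assumes "m \<le> D" "\<forall>i\<in>{1..D}. lam i > 0"
  shows "risk D lam \<delta> (tsvd lam m) \<mu> = variance_upto lam \<delta> m + sq_bias D \<mu> m"
proof -
  interpret prob_space "noise D" by (rule prob_space_noise)
  show ?thesis
    unfolding risk_def tsvd_loss[OF assms]
    using noise_energy_expectation[OF assms(1), of lam \<delta>] by (simp add: prob_space)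
qed

lemma selector_le:
  assumes "sel \<in> selectors m0"
  shows "sel (restrict y {1..m0}) \<le> m0"
proof -
  have "restrict y {1..m0} \<in> space (\<Pi>\<^sub>M i\<in>{1..m0}. (borel :: real measure))"
    by (simp add: space_PiM)
  from measurable_space[OF assms[unfolded selectors_def] this] show ?thesis by simp
qed

text \<open>
  A selector cannot distinguish a signal from its truncation at \<open>m\<close> when it sees
  only the first \<open>m\<close> observations.
\<close>
lemma obs_truncated: "restrict (obs lam \<delta> (truncated m \<mu>) \<epsilon>) {1..m} = restrict (obs lam \<delta> \<mu> \<epsilon>) {1..m}"
  by (auto simp: restrict_def obs_def truncated_def)

lemma selected_loss:
  assumes "m0 \<le> D" "\<forall>i\<in>{1..D}. lam i > 0" "sel \<in> selectors m0"
  shows "(L2_set (\<lambda>i. selected_est lam m0 sel (obs lam \<delta> \<mu> \<epsilon>) i - \<mu> i) {1..D})\<^sup>2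
    = noise_energy lam \<delta> \<epsilon> (sel (restrict (obs lam \<delta> \<mu> \<epsilon>) {1..m0}))
      + sq_bias D \<mu> (sel (restrict (obs lam \<delta> \<mu> \<epsilon>) {1..m0}))"
  unfolding selected_est_def
  using selector_le[OF assms(3), of "obs lam \<delta> \<mu> \<epsilon>"] assms(1,2) by (intro tsvd_loss) auto

text \<open>
  The selector takes the same value under both signals, and neither the estimator nor the
  truncated signal has coordinates beyond \<open>m0\<close>, so these contribute exactly the
  bias at \<open>m0\<close>. This isolates the part of the selected loss that comes from the
  first \<open>m0\<close> coordinates.
\<close>
lemma selected_loss_truncated:
  assumes "m0 \<le> D" "\<forall>i\<in>{1..D}. lam i > 0" "sel \<in> selectors m0"
  shows "(L2_set (\<lambda>i. selected_est lam m0 sel (obs lam \<delta> \<mu> \<epsilon>) i - \<mu> i) {1..D})\<^sup>2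
    = (L2_set (\<lambda>i. selected_est lam m0 sel (obs lam \<delta> (truncated m0 \<mu>) \<epsilon>) i
        - truncated m0 \<mu> i) {1..D})\<^sup>2 + sq_bias D \<mu> m0"
  unfolding selected_loss[OF assms] obs_truncated
  using sq_bias_truncated[OF selector_le[OF assms(3), of "obs lam \<delta> \<mu> \<epsilon>"] assms(1), of \<mu>] by simp

lemma selected_loss_integrable:
  assumes "m0 \<le> D" "\<forall>i\<in>{1..D}. lam i > 0" "sel \<in> selectors m0"
  shows "integrable (noise D)
    (\<lambda>\<epsilon>. (L2_set (\<lambda>i. selected_est lam m0 sel (obs lam \<delta> \<mu> \<epsilon>) i - \<mu> i) {1..D})\<^sup>2)"
proof -
  interpret prob_space "noise D" by (rule prob_space_noise)
  define S where "S \<epsilon> = sel (restrict (obs lam \<delta> \<mu> \<epsilon>) {1..m0})" for \<epsilon>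
  have coord: "(\<lambda>\<epsilon>. \<epsilon> i) \<in> borel_measurable (noise D)" if "i \<in> {1..D}" for i
  proof -
    have "(\<lambda>\<epsilon>. \<epsilon> i) \<in> measurable (noise D) std_normal_distribution"
      unfolding noise_def using that by (rule measurable_component_singleton)
    then show ?thesis by simp
  qed
  have "(\<lambda>\<epsilon>. restrict (obs lam \<delta> \<mu> \<epsilon>) {1..m0}) \<in> measurable (noise D) (\<Pi>\<^sub>M i\<in>{1..m0}. borel)"
  proof (rule measurable_restrict)
    fix i assume "i \<in> {1..m0}"
    with assms(1) have "i \<in> {1..D}" by auto
    from coord[OF this] show "(\<lambda>\<epsilon>. obs lam \<delta> \<mu> \<epsilon> i) \<in> borel_measurable (noise D)"
      unfolding obs_def by measurable
  qed
  from measurable_compose[OF this assms(3)[unfolded selectors_def]]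
  have "S \<in> measurable (noise D) (count_space {0..m0})" by (simp add: S_def[abs_def])
  then have S: "S \<in> measurable (noise D) (count_space UNIV)"
    using measurable_compose[of S "noise D" "count_space {0..m0}" "\<lambda>x. x" "count_space UNIV"] by simp
  have loss: "(L2_set (\<lambda>i. selected_est lam m0 sel (obs lam \<delta> \<mu> \<epsilon>) i - \<mu> i) {1..D})\<^sup>2
      = noise_energy lam \<delta> \<epsilon> (S \<epsilon>) + sq_bias D \<mu> (S \<epsilon>)" for \<epsilon>
    using selected_loss[OF assms] by (simp add: S_def)
  have le: "S \<epsilon> \<le> m0" for \<epsilon> unfolding S_def by (rule selector_le[OF assms(3)])
  have e: "(\<lambda>\<epsilon>. noise_energy lam \<delta> \<epsilon> m) \<in> borel_measurable (noise D)" if "m \<le> m0" for m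
    using that assms(1) by (intro borel_measurable_integrable noise_energy_expectation(1)) auto
  \<comment> \<open>Splitting by the value of the selector exhibits the loss as a finite sum of 
    measurable functions.\<close>
  have eq: "noise_energy lam \<delta> \<epsilon> (S \<epsilon>) + sq_bias D \<mu> (S \<epsilon>)
      = (\<Sum>m\<le>m0. indicator {m} (S \<epsilon>) * (noise_energy lam \<delta> \<epsilon> m + sq_bias D \<mu> m))" for \<epsilon>
    using le[of \<epsilon>] by (simp add: indicator_def sum.delta' if_distrib[of "\<lambda>x. x * _"] cong: if_cong)
  have "(\<lambda>\<epsilon>. indicator {m} (S \<epsilon>) :: real) \<in> borel_measurable (noise D)" for m
    by (rule measurable_compose[OF S]) simp
  with e have meas: "(\<lambda>\<epsilon>. noise_energy lam \<delta> \<epsilon> (S \<epsilon>) + sq_bias D \<mu> (S \<epsilon>)) \<in> borel_measurable (noise D)"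
    unfolding eq by (intro borel_measurable_sum borel_measurable_times borel_measurable_add) auto
  show ?thesis
    unfolding loss
  proof (rule Bochner_Integration.integrable_bound[OF _ meas])
    show "integrable (noise D) (\<lambda>\<epsilon>. noise_energy lam \<delta> \<epsilon> m0 + sq_bias D \<mu> 0)"
      using assms(1) by (intro Bochner_Integration.integrable_add noise_energy_expectation) auto
    show "AE \<epsilon> in noise D. norm (noise_energy lam \<delta> \<epsilon> (S \<epsilon>) + sq_bias D \<mu> (S \<epsilon>))
        \<le> norm (noise_energy lam \<delta> \<epsilon> m0 + sq_bias D \<mu> 0)"
      using le by (intro AE_I2) (auto simp: noise_energy_nonneg sq_bias_nonneg
          intro!: add_mono noise_energy_mono sq_bias_antimono)
  qed
qed

text \<open>
  The assumed inequality for the selector is applied to the truncated signal, which has no bias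
  at \<open>m0\<close>. Therefore the first \<open>m0\<close> coordinates cost at most a
  multiple of \<open>\<delta>\<^sup>2\<close> plus the risk at any \<open>M\<close>, including those beyond \<open>m0\<close>,
  where the bias of the original signal at \<open>m0\<close> may be much larger than the risk at
  \<open>M\<close>.
\<close>
lemma selected_risk_truncated:
  assumes "m0 \<le> D" "M \<le> D" "\<forall>i\<in>{1..D}. lam i > 0" "C \<ge> 0"
    and selector_bound: "\<forall>\<mu>. risk D lam \<delta> (selected_est lam m0 sel) \<mu>
          \<le> C * ((MIN m\<in>{0..m0}. risk D lam \<delta> (tsvd lam m) \<mu>) + \<delta>\<^sup>2)"
  shows "risk D lam \<delta> (selected_est lam m0 sel) (truncated m0 \<mu>)
    \<le> C * (variance_upto lam \<delta> M + sq_bias D \<mu> M + \<delta>\<^sup>2)"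
proof -
  \<comment> \<open>Comparison at \<open>M\<close>, or at \<open>m0\<close> if \<open>M\<close>
    is out of the reach of the selector.\<close>
  define k where "k = min M m0"
  have k: "k \<le> M" "k \<le> m0" "k \<le> D" using assms by (auto simp: k_def)
  have "sq_bias D (truncated m0 \<mu>) k \<le> sq_bias D \<mu> M"
  proof (cases "M \<le> m0")
    case True
    then show ?thesis
      using sq_bias_truncated[of M m0 D \<mu>] assms(1) sq_bias_nonneg[of D \<mu> m0] by (simp add: k_def)
  next
    case False
    then have "sq_bias D (truncated m0 \<mu>) k = 0"
      unfolding sq_bias_def truncated_def k_def by (intro sum.neutral) auto
    then show ?thesis by (simp add: sq_bias_nonneg)
  qed
  then have "risk D lam \<delta> (tsvd lam k) (truncated m0 \<mu>) \<le> variance_upto lam \<delta> M + sq_bias D \<mu> M"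
    unfolding risk_tsvd[OF k(3) assms(3)] using variance_upto_mono[OF k(1)] by (intro add_mono)
  moreover have "(MIN m\<in>{0..m0}. risk D lam \<delta> (tsvd lam m) (truncated m0 \<mu>))
      \<le> risk D lam \<delta> (tsvd lam k) (truncated m0 \<mu>)"
    using k(2) by (intro Min_le) auto
  ultimately show ?thesis
    using selector_bound[rule_format, of "truncated m0 \<mu>"] assms(4)
    by (smt (verit) mult_left_mono)
qed

section \<open>A pointwise bound on the two-step loss\<close>

lemma residual_antimono: "k \<le> m \<Longrightarrow> residual D m y \<le> residual D k y"
  unfolding residual_def by (intro sum_mono2) auto

lemma stop_index_in:
  assumes "m0 \<le> D" "\<kappa> \<ge> 0"
  shows "stop_index D m0 \<kappa> y \<in> {m \<in> {m0..D}. residual D m y \<le> \<kappa>}"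
  unfolding stop_index_def
proof (rule Min_in)
  have "D \<in> {m \<in> {m0..D}. residual D m y \<le> \<kappa>}" using assms by (simp add: residual_def)
  then show "{m \<in> {m0..D}. residual D m y \<le> \<kappa>} \<noteq> {}" by blast
qed simp

lemma stop_index_minimal:
  assumes "m0 \<le> m" "m \<le> D" "m < stop_index D m0 \<kappa> y"
  shows "\<kappa> < residual D m y"
proof (rule ccontr)
  assume "\<not> \<kappa> < residual D m y"
  with assms have "stop_index D m0 \<kappa> y \<le> m" unfolding stop_index_def by (intro Min_le) auto
  with assms show False by simp
qed

text \<open>
  If \<open>t < M\<close>, then residuals at all indices from \<open>t\<close> on are below the
  threshold, so every coordinate in between is paid for by an indicator with a fixed index. In
  this way a random index is replaced by finitely many events, each about a single residual.
  Passing to the weak bias costs the factor \<open>1 / (lam M)\<^sup>2\<close> because the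
  \<open>lam i\<close> decrease.
\<close>
lemma stopped_bias_le:
  assumes "m0 \<le> t" "t \<le> D" "M \<le> D" "residual D t y \<le> \<kappa>"
    and pos: "\<forall>i\<in>{1..D}. lam i > 0"
    and dec: "\<forall>i\<in>{1..D}. \<forall>j\<in>{1..D}. i \<le> j \<longrightarrow> lam j \<le> lam i"
  shows "sq_bias D \<mu> t \<le> sq_bias D \<mu> M
    + (\<Sum>m = m0..<M. (lam (Suc m) * \<mu> (Suc m))\<^sup>2 * of_bool (residual D m y \<le> \<kappa>)) / (lam M)\<^sup>2"
proof (cases "t \<le> M")
  case False
  then show ?thesis
    using sq_bias_antimono[of M t D \<mu>] by (simp add: add_increasing2 sum_nonneg)
next
  case True
  have "(\<mu> i)\<^sup>2 \<le> (lam i * \<mu> i)\<^sup>2 / (lam M)\<^sup>2" if "i \<in> {t + 1..M}" for i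
  proof -
    have i: "i \<in> {1..D}" "M \<in> {1..D}" "i \<le> M" using that True assms by auto
    then have "0 < lam M" "lam M \<le> lam i" using pos dec by auto
    then have "(lam M)\<^sup>2 * (\<mu> i)\<^sup>2 \<le> (lam i)\<^sup>2 * (\<mu> i)\<^sup>2" by (intro mult_right_mono power_mono) auto
    with \<open>0 < lam M\<close> show ?thesis by (simp add: field_simps power_mult_distrib)
  qed
  then have "(\<Sum>i = t + 1..M. (\<mu> i)\<^sup>2) \<le> (\<Sum>i = t + 1..M. (lam i * \<mu> i)\<^sup>2 / (lam M)\<^sup>2)"
    by (intro sum_mono)
  also have "\<dots> = (\<Sum>i = t + 1..M. (lam i * \<mu> i)\<^sup>2) / (lam M)\<^sup>2"
    by (simp add: sum_divide_distrib)
  also have "(\<Sum>i = t + 1..M. (lam i * \<mu> i)\<^sup>2) = (\<Sum>m = t..<M. (lam (Suc m) * \<mu> (Suc m))\<^sup>2)"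
    using sum.shift_bounds_Suc_ivl[of "\<lambda>i. (lam i * \<mu> i)\<^sup>2" t M]
    by (simp add: atLeastLessThanSuc_atLeastAtMost)
  also have "\<dots> = (\<Sum>m = t..<M. (lam (Suc m) * \<mu> (Suc m))\<^sup>2 * of_bool (residual D m y \<le> \<kappa>))"
  proof (intro sum.cong refl)
    fix m assume "m \<in> {t..<M}"
    then have "residual D m y \<le> \<kappa>" using residual_antimono[of t m D y] assms(4) by simp
    then show "(lam (Suc m) * \<mu> (Suc m))\<^sup>2
        = (lam (Suc m) * \<mu> (Suc m))\<^sup>2 * of_bool (residual D m y \<le> \<kappa>)" by simp
  qed
  also have "\<dots> \<le> (\<Sum>m = m0..<M. (lam (Suc m) * \<mu> (Suc m))\<^sup>2 * of_bool (residual D m y \<le> \<kappa>))"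
    using assms(1) by (intro sum_mono2) auto
  finally show ?thesis
    using sq_bias_split[OF True assms(3), of \<mu>] by (simp add: divide_right_mono)
qed

text \<open>
  Stopping beyond a fixed index \<open>n\<close> means that the residual at \<open>n\<close> is
  still above the threshold.
\<close>
lemma stopped_energy_le:
  assumes "m0 \<le> n" "n \<le> D" "t = stop_index D m0 \<kappa> y" "t \<le> D" "m0 < t"
  shows "noise_energy lam \<delta> \<epsilon> t \<le> (if m0 < n then noise_energy lam \<delta> \<epsilon> n else 0)
    + noise_energy lam \<delta> \<epsilon> D * of_bool (\<kappa> < residual D n y)"
proof (cases "n < t")
  case True
  then have "\<kappa> < residual D n y" using assms stop_index_minimal[of m0 n D \<kappa> y] by simp
  then show ?thesis
    using noise_energy_mono[OF assms(4), of lam \<delta> \<epsilon>] noise_energy_nonneg[of lam \<delta> \<epsilon> n] by simp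
next
  case False
  then show ?thesis
    using assms noise_energy_mono[of t n lam \<delta> \<epsilon>] noise_energy_nonneg[of lam \<delta> \<epsilon> D]
    by (auto simp: add_increasing2)
qed

text \<open>
  In both branches of the estimator the coordinates beyond the stopping index contribute the
  strong bias there. The remaining loss is that of the selected estimator on the first
  \<open>m0\<close> coordinates in one branch and the noise energy at the stopping index in the
  other.
\<close>
lemma two_step_loss_le:
  assumes "m0 \<le> D" "m0 \<le> n" "n \<le> D" "M \<le> D" "\<kappa> \<ge> 0" "sel \<in> selectors m0"
    and pos: "\<forall>i\<in>{1..D}. lam i > 0"
    and dec: "\<forall>i\<in>{1..D}. \<forall>j\<in>{1..D}. i \<le> j \<longrightarrow> lam j \<le> lam i"
    and y: "y = obs lam \<delta> \<mu> \<epsilon>"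
  shows "(L2_set (\<lambda>i. two_step_est D lam m0 \<kappa> sel y i - \<mu> i) {1..D})\<^sup>2
    \<le> (L2_set (\<lambda>i. selected_est lam m0 sel (obs lam \<delta> (truncated m0 \<mu>) \<epsilon>) i
          - truncated m0 \<mu> i) {1..D})\<^sup>2
      + (if m0 < n then noise_energy lam \<delta> \<epsilon> n else 0)
      + noise_energy lam \<delta> \<epsilon> D * of_bool (\<kappa> < residual D n y)
      + (sq_bias D \<mu> M
    + (\<Sum>m = m0..<M. (lam (Suc m) * \<mu> (Suc m))\<^sup>2 * of_bool (residual D m y \<le> \<kappa>)) / (lam M)\<^sup>2)"
proof -
  define t where "t = stop_index D m0 \<kappa> y"
  have t: "m0 \<le> t" "t \<le> D" "residual D t y \<le> \<kappa>"
    using stop_index_in[OF assms(1,5), of y] by (auto simp: t_def)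
  note bias = stopped_bias_le[OF t(1,2) assms(4) t(3) pos dec, of \<mu>]
  have nn: "0 \<le> (if m0 < n then noise_energy lam \<delta> \<epsilon> n else 0)"
    "0 \<le> noise_energy lam \<delta> \<epsilon> D * of_bool (\<kappa> < residual D n y)"
    by (simp_all add: noise_energy_nonneg)
  show ?thesis
  proof (cases "t = m0")
    case True
    have "two_step_est D lam m0 \<kappa> sel y = selected_est lam m0 sel y"
      using True by (simp add: two_step_est_def t_def)
    then show ?thesis
      using selected_loss_truncated[OF assms(1) pos assms(6), of \<delta> \<mu> \<epsilon>] bias nn True
      by (simp add: y)
  next
    case False
    have "two_step_est D lam m0 \<kappa> sel y = tsvd lam t y"
      using False by (simp add: two_step_est_def t_def)
    then have "(L2_set (\<lambda>i. two_step_est D lam m0 \<kappa> sel y i - \<mu> i) {1..D})\<^sup>2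
        = noise_energy lam \<delta> \<epsilon> t + sq_bias D \<mu> t"
      using tsvd_loss[OF t(2) pos, of \<delta> \<mu> \<epsilon>] by (simp add: y)
    also have "noise_energy lam \<delta> \<epsilon> t \<le> (if m0 < n then noise_energy lam \<delta> \<epsilon> n else 0)
      + noise_energy lam \<delta> \<epsilon> D * of_bool (\<kappa> < residual D n y)"
      using stopped_energy_le[OF assms(2,3) t_def t(2)] False t(1) by simp
    finally show ?thesis using bias zero_le_power2 by (smt (verit))
  qed
qed

section \<open>The bias of stopping too early\<close>

text \<open>
  For decreasing \<open>b\<close> the summands are areas of rectangles below the graph of
  \<open>exp (- c * x)\<close>, over adjacent intervals of the positive half-line; the bound is
  the area below the whole graph.
\<close>
lemma telescoping_exp_sum:
  fixes b :: "nat \<Rightarrow> real"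
  assumes "c > 0" "b M \<ge> 0"
  shows "(\<Sum>m = k..<M. (b m - b (Suc m)) * exp (- c * b m)) \<le> 1 / c"
proof (cases "k \<le> M")
  case True
  have "(b m - b (Suc m)) * exp (- c * b m) \<le> (exp (- c * b (Suc m)) - exp (- c * b m)) / c" for m
  proof -
    have "1 + c * (b m - b (Suc m)) \<le> exp (c * (b m - b (Suc m)))" by (rule exp_ge_add_one_self)
    then have "(1 + c * (b m - b (Suc m))) * exp (- c * b m)
        \<le> exp (c * (b m - b (Suc m))) * exp (- c * b m)"
      by (intro mult_right_mono) auto
    also have "\<dots> = exp (- c * b (Suc m))" by (simp add: exp_add[symmetric] algebra_simps)
    finally show ?thesis using assms(1) by (simp add: field_simps)
  qed
  then have "(\<Sum>m = k..<M. (b m - b (Suc m)) * exp (- c * b m))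
      \<le> (\<Sum>m = k..<M. (exp (- c * b (Suc m)) - exp (- c * b m)) / c)"
    by (intro sum_mono)
  also have "\<dots> = (exp (- c * b M) - exp (- c * b k)) / c"
    using sum_Suc_diff'[OF True, of "\<lambda>m. exp (- c * b m)"]
    by (simp add: sum_divide_distrib[symmetric])
  also have "\<dots> \<le> 1 / c"
  proof (intro divide_right_mono)
    have "exp (- c * b M) \<le> 1" using assms by simp
    then show "exp (- c * b M) - exp (- c * b k) \<le> 1" by (smt (verit) exp_gt_zero)
  qed (use assms in auto)
  finally show ?thesis .
qed (use assms in simp)

text \<open>
  Chernoff bound at the rate \<open>1 / M\<close>. The noise fluctuation and the
  misspecification of \<open>\<kappa>\<close> are of order \<open>sqrt D \<le> M\<close> and the
  deficit of \<open>D - m\<close> noise terms against \<open>D\<close> is at most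
  \<open>M\<close>, so at this rate all three cost a bounded factor only.
\<close>
lemma early_stop_moment:
  assumes "\<delta> > 0" "m \<le> M" "M \<le> D" "sqrt (real D) \<le> real M" "4 \<le> M"
    and "\<bar>\<kappa> - real D * \<delta>\<^sup>2\<bar> \<le> K * sqrt (real D) * \<delta>\<^sup>2" "K \<ge> 0"
  shows "integrable (noise D) (\<lambda>\<epsilon>. exp ((\<kappa> - residual D m (obs lam \<delta> \<mu> \<epsilon>)) / (\<delta>\<^sup>2 * real M)))"
    and "(\<integral>\<epsilon>. exp ((\<kappa> - residual D m (obs lam \<delta> \<mu> \<epsilon>)) / (\<delta>\<^sup>2 * real M)) \<partial>noise D)
      \<le> exp (K + 5) * exp (- (1 / (2 * real M * \<delta>\<^sup>2)) * sq_bias D (\<lambda>i. lam i * \<mu> i) m)"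
proof -
  define u where "u = 1 / real M"
  define b where "b = sq_bias D (\<lambda>i. lam i * \<mu> i) m / \<delta>\<^sup>2"
  have u: "0 < u" "u \<le> 1 / 4" using assms(5) by (auto simp: u_def field_simps)
  have b: "0 \<le> b" by (simp add: b_def sq_bias_nonneg)
  have eq: "exp ((\<kappa> - residual D m (obs lam \<delta> \<mu> \<epsilon>)) / (\<delta>\<^sup>2 * real M))
      = exp (u * (\<kappa> / \<delta>\<^sup>2)) * exp (- u * (residual D m (obs lam \<delta> \<mu> \<epsilon>) / \<delta>\<^sup>2))" for \<epsilon>
    unfolding exp_add[symmetric] u_def using assms(1,5) by (simp add: field_simps)
  show "integrable (noise D) (\<lambda>\<epsilon>. exp ((\<kappa> - residual D m (obs lam \<delta> \<mu> \<epsilon>)) / (\<delta>\<^sup>2 * real M)))"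
    unfolding eq using u assms(1) by (intro integrable_mult_right residual_exp_moment) auto
  have "(\<integral>\<epsilon>. exp ((\<kappa> - residual D m (obs lam \<delta> \<mu> \<epsilon>)) / (\<delta>\<^sup>2 * real M)) \<partial>noise D)
      = exp (u * (\<kappa> / \<delta>\<^sup>2)) * (\<integral>\<epsilon>. exp (- u * (residual D m (obs lam \<delta> \<mu> \<epsilon>) / \<delta>\<^sup>2)) \<partial>noise D)"
    unfolding eq by simp
  also have "\<dots> \<le> exp (u * (\<kappa> / \<delta>\<^sup>2))
      * exp (real (D - m) * (- u + 4 * (- u)\<^sup>2) + (- u) / (1 - 2 * (- u)) * b)"
    unfolding b_def using u assms(1) by (intro mult_left_mono residual_exp_moment_le) auto
  also have "\<dots> \<le> exp (K + 5 - u / 2 * b)"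
    unfolding exp_add[symmetric] exp_le_cancel_iff
  proof -
    have "\<kappa> \<le> real D * \<delta>\<^sup>2 + K * sqrt (real D) * \<delta>\<^sup>2" using assms(6) by linarith
    then have "\<kappa> / \<delta>\<^sup>2 \<le> real D + K * sqrt (real D)" using assms(1) by (simp add: field_simps)
    then have k1: "u * (\<kappa> / \<delta>\<^sup>2) \<le> u * (real D + K * sqrt (real D))"
      using u by (intro mult_left_mono) auto
    have us: "u * sqrt (real D) \<le> 1" using assms(4,5) by (simp add: u_def field_simps)
    then have k2: "K * (u * sqrt (real D)) \<le> K" using assms(7) by (simp add: mult_left_le)
    have "(u * sqrt (real D))\<^sup>2 \<le> 1\<^sup>2" using us u by (intro power_mono) auto
    then have k3: "u\<^sup>2 * real D \<le> 1" by (simp add: power_mult_distrib)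
    have k4: "u * real m \<le> 1" using assms(2,5) by (simp add: u_def field_simps)
    have d: "real (D - m) = real D - real m" using assms(2,3) by simp
    have k5: "u / 2 * b \<le> u / (1 + 2 * u) * b"
      using u b by (intro mult_right_mono divide_left_mono) auto
    have k6: "u\<^sup>2 * real m \<ge> 0" by simp
    \<comment> \<open>With \<open>u = 1 / M\<close> the terms of order \<open>D * u\<close>
      cancel; of the rest, \<open>u * m\<close>, \<open>u\<^sup>2 * D\<close> and
      \<open>u * sqrt D\<close> are at most 1.\<close>
    have "u * (real D + K * sqrt (real D)) + (real D - real m) * (- u + 4 * u\<^sup>2)
        = u * real m + K * (u * sqrt (real D)) + 4 * (u\<^sup>2 * real D) - 4 * (u\<^sup>2 * real m)"
      by (simp add: algebra_simps)
    with k2 k3 k4 k6 have "u * (real D + K * sqrt (real D)) + (real D - real m) * (- u + 4 * u\<^sup>2) \<le> K + 5"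
      by linarith
    with k1 k5 show "u * (\<kappa> / \<delta>\<^sup>2) + (real (D - m) * (- u + 4 * (- u)\<^sup>2) + (- u) / (1 - 2 * (- u)) * b)
        \<le> K + 5 - u / 2 * b"
      unfolding d by simp
  qed
  also have "\<dots> = exp (K + 5) * exp (- (1 / (2 * real M * \<delta>\<^sup>2)) * sq_bias D (\<lambda>i. lam i * \<mu> i) m)"
    unfolding exp_add[symmetric] by (simp add: u_def b_def)
  finally show "(\<integral>\<epsilon>. exp ((\<kappa> - residual D m (obs lam \<delta> \<mu> \<epsilon>)) / (\<delta>\<^sup>2 * real M)) \<partial>noise D)
      \<le> exp (K + 5) * exp (- (1 / (2 * real M * \<delta>\<^sup>2)) * sq_bias D (\<lambda>i. lam i * \<mu> i) m)" .
qed

text \<open>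
  The exponential decay in the weak bias, summed against the decrements of the weak bias itself,
  telescopes to the inverse rate. Chebyshev bounds for the single events would lose a logarithm
  here.
\<close>
lemma early_stop_weak_bias:
  assumes "\<delta> > 0" "M \<le> D" "sqrt (real D) \<le> real M" "4 \<le> M"
    and "\<bar>\<kappa> - real D * \<delta>\<^sup>2\<bar> \<le> K * sqrt (real D) * \<delta>\<^sup>2" "K \<ge> 0"
  shows "(\<integral>\<epsilon>. (\<Sum>m = m0..<M. (lam (Suc m) * \<mu> (Suc m))\<^sup>2
        * exp ((\<kappa> - residual D m (obs lam \<delta> \<mu> \<epsilon>)) / (\<delta>\<^sup>2 * real M))) \<partial>noise D)
      \<le> exp (K + 5) * (2 * real M * \<delta>\<^sup>2)"
proof -
  define b where "b = sq_bias D (\<lambda>i. lam i * \<mu> i)"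
  define c where "c = 1 / (2 * real M * \<delta>\<^sup>2)"
  have c: "c > 0" using assms(1,4) by (simp add: c_def)
  note moment = early_stop_moment[OF assms(1) _ assms(2-6)]
  have "(\<integral>\<epsilon>. (\<Sum>m = m0..<M. (lam (Suc m) * \<mu> (Suc m))\<^sup>2
        * exp ((\<kappa> - residual D m (obs lam \<delta> \<mu> \<epsilon>)) / (\<delta>\<^sup>2 * real M))) \<partial>noise D)
      = (\<Sum>m = m0..<M. (lam (Suc m) * \<mu> (Suc m))\<^sup>2
        * (\<integral>\<epsilon>. exp ((\<kappa> - residual D m (obs lam \<delta> \<mu> \<epsilon>)) / (\<delta>\<^sup>2 * real M)) \<partial>noise D))"
    using moment(1) by (subst Bochner_Integration.integral_sum) auto
  also have "\<dots> \<le> (\<Sum>m = m0..<M. (lam (Suc m) * \<mu> (Suc m))\<^sup>2 * (exp (K + 5) * exp (- c * b m)))"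
    unfolding b_def c_def using moment(2) by (intro sum_mono mult_left_mono) auto
  also have "\<dots> = exp (K + 5) * (\<Sum>m = m0..<M. (b m - b (Suc m)) * exp (- c * b m))"
    unfolding sum_distrib_left b_def using assms(2)
    by (intro sum.cong refl) (simp add: sq_bias_step)
  also have "\<dots> \<le> exp (K + 5) * (1 / c)"
    using c by (intro mult_left_mono telescoping_exp_sum) (auto simp: b_def sq_bias_nonneg)
  finally show ?thesis by (simp add: c_def)
qed

lemma singular_value_ratio:
  assumes "p \<ge> 0" "C\<^sub>A \<ge> 1" "i \<in> {1..D}" "M \<in> {1..D}" "M \<le> 2 * i"
    and poly: "\<forall>i\<in>{1..D}. inverse C\<^sub>A * real i powr (- p) \<le> lam i \<and> lam i \<le> C\<^sub>A * real i powr (- p)"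
  shows "lam i \<le> C\<^sub>A\<^sup>2 * 2 powr p * lam M"
proof -
  have "real M powr p \<le> (2 * real i) powr p" using assms by (intro powr_mono2) auto
  also have "\<dots> = 2 powr p * real i powr p" using assms by (simp add: powr_mult)
  finally have "real i powr (- p) \<le> 2 powr p * real M powr (- p)"
    using assms by (simp add: powr_minus field_simps)
  moreover have "real M powr (- p) \<le> C\<^sub>A * lam M"
    using poly[rule_format, OF assms(4)] assms(2) by (simp add: field_simps)
  ultimately have "real i powr (- p) \<le> 2 powr p * (C\<^sub>A * lam M)"
    by (smt (verit) mult_left_mono powr_ge_zero)
  then have "C\<^sub>A * real i powr (- p) \<le> C\<^sub>A * (2 powr p * (C\<^sub>A * lam M))"
    using assms(2) by (intro mult_left_mono) auto
  moreover have "lam i \<le> C\<^sub>A * real i powr (- p)" using poly assms(3) by blast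
  ultimately show ?thesis by (simp add: power2_eq_square mult_ac)
qed

text \<open>
  By the polynomial decay of \<open>lam\<close>, the summands of the variance in the upper half
  of the index range are all comparable to the last one.
\<close>
lemma last_variance_le:
  assumes "p \<ge> 0" "C\<^sub>A \<ge> 1" "M \<le> D" "\<delta> > 0"
    and poly: "\<forall>i\<in>{1..D}. inverse C\<^sub>A * real i powr (- p) \<le> lam i \<and> lam i \<le> C\<^sub>A * real i powr (- p)"
    and pos: "\<forall>i\<in>{1..D}. lam i > 0"
  shows "real M * (\<delta> / lam M)\<^sup>2 \<le> 2 * (C\<^sub>A\<^sup>2 * 2 powr p)\<^sup>2 * variance_upto lam \<delta> M"
proof (cases "M = 0")
  case True
  then show ?thesis by (simp add: variance_upto_nonneg)
next
  case False
  define c where "c = C\<^sub>A\<^sup>2 * 2 powr p"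
  define k where "k = (M + 1) div 2"
  have M: "M \<in> {1..D}" using False assms by auto
  have c: "c > 0" using assms by (simp add: c_def)
  have ratio: "(\<delta> / lam M)\<^sup>2 \<le> c\<^sup>2 * (\<delta> / lam i)\<^sup>2" if "i \<in> {k..M}" for i
  proof -
    have i: "i \<in> {1..D}" "M \<le> 2 * i" using that False assms(3) by (auto simp: k_def)
    have "lam i \<le> c * lam M"
      unfolding c_def using singular_value_ratio[OF assms(1,2) i(1) M i(2) poly] .
    moreover have "0 < lam i" "0 < lam M" using pos i(1) M by auto
    ultimately have "\<delta> / lam M \<le> c * (\<delta> / lam i)"
      using assms(4) by (simp add: field_simps)
    then have "(\<delta> / lam M)\<^sup>2 \<le> (c * (\<delta> / lam i))\<^sup>2"
      using \<open>0 < lam M\<close> assms(4) by (intro power_mono) auto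
    then show ?thesis by (simp only: power_mult_distrib)
  qed
  have "real M / 2 \<le> real (card {k..M})" by (simp add: k_def)
  then have "real M / 2 * (\<delta> / lam M)\<^sup>2 \<le> real (card {k..M}) * (\<delta> / lam M)\<^sup>2"
    by (intro mult_right_mono) auto
  also have "\<dots> = (\<Sum>i = k..M. (\<delta> / lam M)\<^sup>2)" by simp
  also have "\<dots> \<le> (\<Sum>i = k..M. c\<^sup>2 * (\<delta> / lam i)\<^sup>2)" using ratio by (rule sum_mono)
  also have "\<dots> \<le> (\<Sum>i = 1..M. c\<^sup>2 * (\<delta> / lam i)\<^sup>2)"
    using False by (intro sum_mono2) (auto simp: k_def)
  also have "\<dots> = c\<^sup>2 * variance_upto lam \<delta> M" by (simp add: variance_upto_def sum_distrib_left)
  finally show ?thesis by (simp add: c_def)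
qed

text \<open>
  Dominating each indicator by an exponential gives the integrable majorant \<open>g\<close>,
  and dividing the resulting \<open>M * \<delta>\<^sup>2\<close> by
  \<open>(lam M)\<^sup>2\<close> gives the order of the variance at \<open>M\<close>.
\<close>
lemma early_stop_strong_bias:
  assumes "p \<ge> 0" "C\<^sub>A \<ge> 1" "\<delta> > 0" "M \<le> D" "sqrt (real D) \<le> real m0" "4 \<le> m0" "K \<ge> 0"
    and kappa: "\<bar>\<kappa> - real D * \<delta>\<^sup>2\<bar> \<le> K * sqrt (real D) * \<delta>\<^sup>2"
    and poly: "\<forall>i\<in>{1..D}. inverse C\<^sub>A * real i powr (- p) \<le> lam i \<and> lam i \<le> C\<^sub>A * real i powr (- p)"
    and pos: "\<forall>i\<in>{1..D}. lam i > 0"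
  obtains g where "integrable (noise D) g"
    "\<And>\<epsilon>. (\<Sum>m = m0..<M. (lam (Suc m) * \<mu> (Suc m))\<^sup>2
        * of_bool (residual D m (obs lam \<delta> \<mu> \<epsilon>) \<le> \<kappa>)) / (lam M)\<^sup>2 \<le> g \<epsilon>"
    "(\<integral>\<epsilon>. g \<epsilon> \<partial>noise D) \<le> 4 * exp (K + 5) * (C\<^sub>A\<^sup>2 * 2 powr p)\<^sup>2 * variance_upto lam \<delta> M"
proof (cases "m0 \<le> M")
  case False
  then show ?thesis using that[of "\<lambda>_. 0"] by (simp add: variance_upto_nonneg)
next
  case True
  have M: "sqrt (real D) \<le> real M" "4 \<le> M" using True assms by auto
  define g where "g \<epsilon> = (\<Sum>m = m0..<M. (lam (Suc m) * \<mu> (Suc m))\<^sup>2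
        * exp ((\<kappa> - residual D m (obs lam \<delta> \<mu> \<epsilon>)) / (\<delta>\<^sup>2 * real M))) / (lam M)\<^sup>2" for \<epsilon>
  show ?thesis
  proof
    show "integrable (noise D) g"
      unfolding g_def[abs_def] using M assms
      by (intro integrable_divide_zero Bochner_Integration.integrable_sum impI
          integrable_mult_right early_stop_moment(1)[OF assms(3) _ assms(4) M kappa assms(7)]) auto
    show "(\<Sum>m = m0..<M. (lam (Suc m) * \<mu> (Suc m))\<^sup>2
        * of_bool (residual D m (obs lam \<delta> \<mu> \<epsilon>) \<le> \<kappa>)) / (lam M)\<^sup>2 \<le> g \<epsilon>" for \<epsilon>
      unfolding g_def
    proof (intro divide_right_mono sum_mono mult_left_mono)
      fix m
      show "of_bool (residual D m (obs lam \<delta> \<mu> \<epsilon>) \<le> \<kappa>)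
          \<le> exp ((\<kappa> - residual D m (obs lam \<delta> \<mu> \<epsilon>)) / (\<delta>\<^sup>2 * real M))"
        by (cases "residual D m (obs lam \<delta> \<mu> \<epsilon>) \<le> \<kappa>") auto
    qed auto
    have "(\<integral>\<epsilon>. g \<epsilon> \<partial>noise D) = (\<integral>\<epsilon>. (\<Sum>m = m0..<M. (lam (Suc m) * \<mu> (Suc m))\<^sup>2
        * exp ((\<kappa> - residual D m (obs lam \<delta> \<mu> \<epsilon>)) / (\<delta>\<^sup>2 * real M))) \<partial>noise D) / (lam M)\<^sup>2"
      unfolding g_def by simp
    also have "\<dots> \<le> exp (K + 5) * (2 * real M * \<delta>\<^sup>2) / (lam M)\<^sup>2"
      by (intro divide_right_mono early_stop_weak_bias[OF assms(3,4) M kappa assms(7)]) auto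
    also have "\<dots> = 2 * exp (K + 5) * (real M * (\<delta> / lam M)\<^sup>2)" by (simp add: power_divide)
    also have "\<dots> \<le> 2 * exp (K + 5) * (2 * (C\<^sub>A\<^sup>2 * 2 powr p)\<^sup>2 * variance_upto lam \<delta> M)"
      by (intro mult_left_mono last_variance_le[OF assms(1,2,4,3) poly pos]) auto
    finally show "(\<integral>\<epsilon>. g \<epsilon> \<partial>noise D)
        \<le> 4 * exp (K + 5) * (C\<^sub>A\<^sup>2 * 2 powr p)\<^sup>2 * variance_upto lam \<delta> M" by (simp add: mult_ac)
  qed
qed

section \<open>The noise of stopping too late\<close>

text \<open>
  The factor \<open>ln D\<close> is at least 1 because \<open>exp 1 \<le> 3\<close>. That the
  starting index fits below \<open>D\<close> forces \<open>D\<close> to be large.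
\<close>
lemma start_index_bounds:
  assumes "D \<ge> 3" "start_index D \<le> D"
  shows "1 \<le> ln (real D)" "128 * ln (real D) * sqrt (real D) \<le> real (start_index D)"
    "128 * ln (real D) \<le> sqrt (real D)" "sqrt (real D) \<le> real (start_index D)" "128 \<le> start_index D"
proof -
  have "exp 1 \<le> real D" using exp_le assms(1) by linarith
  then show L: "1 \<le> ln (real D)" using assms(1) by (subst ln_ge_iff) auto
  have "128 * ln (real D) * sqrt (real D) \<ge> 0" using L by simp
  then show m: "128 * ln (real D) * sqrt (real D) \<le> real (start_index D)"
    unfolding start_index_def by linarith
  have "128 * ln (real D) * sqrt (real D) \<le> sqrt (real D) * sqrt (real D)"
    using m assms(2) by simp
  then show s: "128 * ln (real D) \<le> sqrt (real D)"
    by (rule mult_right_le_imp_le) (use assms(1) in simp)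
  have "1 * sqrt (real D) \<le> 128 * ln (real D) * sqrt (real D)"
    using L by (intro mult_right_mono) auto
  with m show s': "sqrt (real D) \<le> real (start_index D)" by simp
  show "128 \<le> start_index D" using s s' L by linarith
qed

text \<open>
  Up to the error of \<open>\<kappa>\<close>, the threshold exceeds the mean of the residual by
  at least \<open>3 / 4 * n * \<delta>\<^sup>2\<close>, and \<open>n\<close> is larger than the
  scale \<open>sqrt D\<close> of the fluctuations by a factor of order \<open>ln D\<close>. The
  rate \<open>ln D / sqrt D\<close> therefore gives a bound that is smaller than every power of
  \<open>D\<close>.
\<close>
lemma late_stop_moment:
  fixes D :: nat
  defines "s \<equiv> ln (real D) / sqrt (real D)"
  assumes "\<delta> > 0" "n \<le> D" "D \<ge> 3" "start_index D \<le> n"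
    and "sq_bias D (\<lambda>i. lam i * \<mu> i) n \<le> real n * \<delta>\<^sup>2 / 4"
    and "\<bar>\<kappa> - real D * \<delta>\<^sup>2\<bar> \<le> K * sqrt (real D) * \<delta>\<^sup>2"
  shows "integrable (noise D) (\<lambda>\<epsilon>. exp (s * ((residual D n (obs lam \<delta> \<mu> \<epsilon>) - \<kappa>) / \<delta>\<^sup>2)))"
    and "(\<integral>\<epsilon>. exp (s * ((residual D n (obs lam \<delta> \<mu> \<epsilon>) - \<kappa>) / \<delta>\<^sup>2)) \<partial>noise D)
      \<le> exp (K * ln (real D) - 60 * (ln (real D))\<^sup>2)"
proof -
  define L where "L = ln (real D)"
  define b where "b = sq_bias D (\<lambda>i. lam i * \<mu> i) n / \<delta>\<^sup>2"
  have idx: "start_index D \<le> D" using assms by simp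
  note ix = start_index_bounds[OF \<open>D \<ge> 3\<close> idx, folded L_def]
  have sq: "sqrt (real D) > 0" using assms by simp
  have s: "0 < s" "s \<le> 1 / 4" using ix(1,3) sq by (auto simp: s_def L_def[symmetric] field_simps)
  have b: "0 \<le> b" "b \<le> real n / 4" using assms by (auto simp: b_def sq_bias_nonneg field_simps)
  have eq: "exp (s * ((residual D n (obs lam \<delta> \<mu> \<epsilon>) - \<kappa>) / \<delta>\<^sup>2))
      = exp (- s * (\<kappa> / \<delta>\<^sup>2)) * exp (s * (residual D n (obs lam \<delta> \<mu> \<epsilon>) / \<delta>\<^sup>2))" for \<epsilon>
    unfolding exp_add[symmetric] by (simp add: diff_divide_distrib algebra_simps)
  show "integrable (noise D) (\<lambda>\<epsilon>. exp (s * ((residual D n (obs lam \<delta> \<mu> \<epsilon>) - \<kappa>) / \<delta>\<^sup>2)))"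
    unfolding eq using s assms(2) by (intro integrable_mult_right residual_exp_moment(1)) linarith+
  have "(\<integral>\<epsilon>. exp (s * ((residual D n (obs lam \<delta> \<mu> \<epsilon>) - \<kappa>) / \<delta>\<^sup>2)) \<partial>noise D)
      = exp (- s * (\<kappa> / \<delta>\<^sup>2)) * (\<integral>\<epsilon>. exp (s * (residual D n (obs lam \<delta> \<mu> \<epsilon>) / \<delta>\<^sup>2)) \<partial>noise D)"
    unfolding eq by simp
  also have "\<dots> \<le> exp (- s * (\<kappa> / \<delta>\<^sup>2))
      * exp (real (D - n) * (s + 4 * s\<^sup>2) + s / (1 - 2 * s) * b)"
    unfolding b_def using s assms by (intro mult_left_mono residual_exp_moment_le) auto
  also have "\<dots> \<le> exp (K * L - 60 * L\<^sup>2)"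
    unfolding exp_add[symmetric] exp_le_cancel_iff
  proof -
    have "real D * \<delta>\<^sup>2 - K * sqrt (real D) * \<delta>\<^sup>2 \<le> \<kappa>" using assms by linarith
    then have "real D - K * sqrt (real D) \<le> \<kappa> / \<delta>\<^sup>2" using assms by (simp add: field_simps)
    then have k1: "s * (real D - K * sqrt (real D)) \<le> s * (\<kappa> / \<delta>\<^sup>2)"
      using s by (intro mult_left_mono) auto
    have us: "s * sqrt (real D) = L" using sq by (simp add: s_def L_def)
    then have "(s * sqrt (real D))\<^sup>2 = L\<^sup>2" by simp
    then have k3: "s\<^sup>2 * real D = L\<^sup>2" by (simp add: power_mult_distrib)
    have "128 * L * sqrt (real D) \<le> real n" using ix(2) assms by simp
    then have "s * (128 * L * sqrt (real D)) \<le> s * real n" using s by (intro mult_left_mono) auto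
    moreover have "s * (128 * L * sqrt (real D)) = 128 * L\<^sup>2"
      unfolding us[symmetric] by (simp add: power2_eq_square)
    ultimately have k4: "128 * L\<^sup>2 \<le> s * real n" by simp
    have d: "real (D - n) = real D - real n" using assms by simp
    have "s / (1 - 2 * s) \<le> 2 * s" using s by (simp add: field_simps)
    then have "s / (1 - 2 * s) * b \<le> 2 * s * (real n / 4)" using s b by (intro mult_mono) auto
    moreover have "s\<^sup>2 * real n \<ge> 0" by simp
    moreover have "s * (real D - K * sqrt (real D)) = s * real D - K * L"
      unfolding us[symmetric] by (simp add: algebra_simps)
    \<comment> \<open>The terms \<open>s * D\<close> cancel against \<open>\<kappa>\<close>.
      What remains of order \<open>s * n\<close> is at most
      \<open>- s * n / 2 \<le> - 64 * L\<^sup>2\<close>, and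
      \<open>4 * s\<^sup>2 * D = 4 * L\<^sup>2\<close>.\<close>
    moreover have "(real D - real n) * (s + 4 * s\<^sup>2)
        = s * real D - s * real n + 4 * (s\<^sup>2 * real D) - 4 * (s\<^sup>2 * real n)"
      by (simp add: algebra_simps)
    ultimately show "- s * (\<kappa> / \<delta>\<^sup>2) + (real (D - n) * (s + 4 * s\<^sup>2) + s / (1 - 2 * s) * b)
        \<le> K * L - 60 * L\<^sup>2"
      using k1 k3 k4 unfolding d by linarith
  qed
  finally show "(\<integral>\<epsilon>. exp (s * ((residual D n (obs lam \<delta> \<mu> \<epsilon>) - \<kappa>) / \<delta>\<^sup>2)) \<partial>noise D)
      \<le> exp (K * ln (real D) - 60 * (ln (real D))\<^sup>2)" by (simp add: L_def)
qed

lemma full_variance_le: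
  assumes "p \<ge> 0" "C\<^sub>A \<ge> 1" "D \<ge> 1"
    and poly: "\<forall>i\<in>{1..D}. inverse C\<^sub>A * real i powr (- p) \<le> lam i \<and> lam i \<le> C\<^sub>A * real i powr (- p)"
    and pos: "\<forall>i\<in>{1..D}. lam i > 0"
  shows "variance_upto lam \<delta> D \<le> \<delta>\<^sup>2 * C\<^sub>A\<^sup>2 * real D powr (2 * p + 1)"
proof -
  have "(\<delta> / lam i)\<^sup>2 \<le> \<delta>\<^sup>2 * C\<^sub>A\<^sup>2 * real D powr (2 * p)" if i: "i \<in> {1..D}" for i
  proof -
    have "lam i > 0" using pos i by blast
    have "real i powr (- p) \<le> C\<^sub>A * lam i"
      using poly[rule_format, OF i] assms(2) by (simp add: field_simps)
    then have "1 / lam i \<le> C\<^sub>A * real i powr p"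
      using i \<open>lam i > 0\<close> by (simp add: powr_minus field_simps)
    also have "\<dots> \<le> C\<^sub>A * real D powr p" using i assms by (intro mult_left_mono powr_mono2) auto
    finally have "(1 / lam i)\<^sup>2 \<le> (C\<^sub>A * real D powr p)\<^sup>2"
      using \<open>lam i > 0\<close> by (intro power_mono) auto
    also have "\<dots> = C\<^sub>A\<^sup>2 * real D powr (2 * p)"
      by (simp add: power_mult_distrib power2_eq_square powr_add[symmetric])
    finally have "\<delta>\<^sup>2 * (1 / lam i)\<^sup>2 \<le> \<delta>\<^sup>2 * (C\<^sub>A\<^sup>2 * real D powr (2 * p))"
      by (intro mult_left_mono) auto
    then show ?thesis by (simp add: power_divide mult.assoc)
  qed
  then have "variance_upto lam \<delta> D \<le> (\<Sum>i = 1..D. \<delta>\<^sup>2 * C\<^sub>A\<^sup>2 * real D powr (2 * p))"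
    unfolding variance_upto_def by (rule sum_mono)
  also have "\<dots> = \<delta>\<^sup>2 * C\<^sub>A\<^sup>2 * real D powr (2 * p + 1)"
    using assms(3) by (simp add: powr_add mult_ac)
  finally show ?thesis .
qed

text \<open>
  Serves to separate the square of a noise coordinate from the indicator of a rare event.
\<close>
lemma square_le_fourth_power:
  fixes x N :: real
  assumes "N > 0"
  shows "x\<^sup>2 \<le> (x ^ 4 / N + N) / 2"
proof -
  have "0 \<le> (x\<^sup>2 - N)\<^sup>2" by simp
  then have "2 * N * x\<^sup>2 \<le> x ^ 4 + N\<^sup>2" by (simp add: power2_eq_square algebra_simps power4_eq_xxxx)
  with assms show ?thesis by (simp add: field_simps power2_eq_square)
qed

text \<open>
  Even the whole noise energy is harmless on the event that the residual at \<open>n\<close>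
  exceeds the threshold: the probability of this event decays faster than any power of
  \<open>D\<close>, while the variance grows like a power. The constant depends on
  \<open>p\<close> through this comparison.
\<close>
lemma late_stop_energy:
  assumes "p \<ge> 0" "C\<^sub>A \<ge> 1" "\<delta> > 0" "n \<le> D" "D \<ge> 3" "start_index D \<le> n"
    and weak: "sq_bias D (\<lambda>i. lam i * \<mu> i) n \<le> real n * \<delta>\<^sup>2 / 4"
    and kappa: "\<bar>\<kappa> - real D * \<delta>\<^sup>2\<bar> \<le> K * sqrt (real D) * \<delta>\<^sup>2"
    and poly: "\<forall>i\<in>{1..D}. inverse C\<^sub>A * real i powr (- p) \<le> lam i \<and> lam i \<le> C\<^sub>A * real i powr (- p)"
    and pos: "\<forall>i\<in>{1..D}. lam i > 0"
  obtains g where "integrable (noise D) g"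
    "\<And>\<epsilon>. noise_energy lam \<delta> \<epsilon> D * of_bool (\<kappa> < residual D n (obs lam \<delta> \<mu> \<epsilon>)) \<le> g \<epsilon>"
    "(\<integral>\<epsilon>. g \<epsilon> \<partial>noise D) \<le> C\<^sub>A\<^sup>2 * (3 + exp ((K + 4 * p + 2)\<^sup>2 / 240)) / 2 * \<delta>\<^sup>2"
proof
  define L where "L = ln (real D)"
  \<comment> \<open>The weight \<open>N\<close> in the weighted arithmetic-geometric inequality
    bounds \<open>variance_upto lam \<delta> D / \<delta>\<^sup>2\<close> up to a constant, so
    that the fourth-moment part is of order \<open>\<delta>\<^sup>2\<close>.\<close>
  define N where "N = real D powr (2 * p + 1)"
  have N: "N > 0" using assms by (simp add: N_def)
  define X where "X \<epsilon> = exp (ln (real D) / sqrt (real D)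
      * ((residual D n (obs lam \<delta> \<mu> \<epsilon>) - \<kappa>) / \<delta>\<^sup>2))" for \<epsilon>
  note moment = late_stop_moment[OF assms(3-6) weak kappa, folded X_def L_def]
  define g where "g \<epsilon> = (\<Sum>i = 1..D. (\<delta> / lam i)\<^sup>2 * (((\<epsilon> i) ^ 4 / N + N * X \<epsilon>) / 2))" for \<epsilon>
  have int: "integrable (noise D) (\<lambda>\<epsilon>. (\<delta> / lam i)\<^sup>2 * (((\<epsilon> i) ^ 4 / N + N * X \<epsilon>) / 2))"
    if "i \<in> {1..D}" for i
    using moment(1) noise_fourth_moment(1)[OF that] by auto
  show "integrable (noise D) g"
    unfolding g_def[abs_def] using int by (rule Bochner_Integration.integrable_sum)
  show "noise_energy lam \<delta> \<epsilon> D * of_bool (\<kappa> < residual D n (obs lam \<delta> \<mu> \<epsilon>)) \<le> g \<epsilon>" for \<epsilon>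
    unfolding g_def noise_energy_def sum_distrib_right mult.assoc
  proof (intro sum_mono mult_left_mono)
    fix i
    let ?B = "\<kappa> < residual D n (obs lam \<delta> \<mu> \<epsilon>)"
    have "0 < X \<epsilon>" by (simp add: X_def)
    have "1 \<le> X \<epsilon>" if ?B
      using that assms(3,5) by (simp add: X_def)
    then have "N \<le> N * X \<epsilon>" if ?B
      using that N by simp
    moreover have "0 \<le> (\<epsilon> i) ^ 4 / N" "0 \<le> N * X \<epsilon>" using N \<open>0 < X \<epsilon>\<close> by auto
    ultimately show "(\<epsilon> i)\<^sup>2 * of_bool ?B \<le> ((\<epsilon> i) ^ 4 / N + N * X \<epsilon>) / 2"
      using square_le_fourth_power[OF N, of "\<epsilon> i"] by (cases ?B) auto
  qed auto
  have X0: "0 \<le> (\<integral>\<epsilon>. X \<epsilon> \<partial>noise D)" by (intro Bochner_Integration.integral_nonneg) (simp add: X_def)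
  have "(\<integral>\<epsilon>. g \<epsilon> \<partial>noise D)
      = (\<Sum>i = 1..D. \<integral>\<epsilon>. (\<delta> / lam i)\<^sup>2 * (((\<epsilon> i) ^ 4 / N + N * X \<epsilon>) / 2) \<partial>noise D)"
    unfolding g_def using int by (rule Bochner_Integration.integral_sum)
  also have "\<dots> = (\<Sum>i = 1..D. (\<delta> / lam i)\<^sup>2 * ((3 / N + N * (\<integral>\<epsilon>. X \<epsilon> \<partial>noise D)) / 2))"
  proof (intro sum.cong refl)
    fix i assume i: "i \<in> {1..D}"
    show "(\<integral>\<epsilon>. (\<delta> / lam i)\<^sup>2 * (((\<epsilon> i) ^ 4 / N + N * X \<epsilon>) / 2) \<partial>noise D)
        = (\<delta> / lam i)\<^sup>2 * ((3 / N + N * (\<integral>\<epsilon>. X \<epsilon> \<partial>noise D)) / 2)"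
      using moment(1) noise_fourth_moment[OF i] by simp
  qed
  also have "\<dots> = variance_upto lam \<delta> D * ((3 / N + N * (\<integral>\<epsilon>. X \<epsilon> \<partial>noise D)) / 2)"
    by (simp only: variance_upto_def sum_distrib_right)
  also have "\<dots> \<le> (\<delta>\<^sup>2 * C\<^sub>A\<^sup>2 * N) * ((3 / N + N * exp (K * L - 60 * L\<^sup>2)) / 2)"
  proof (intro mult_mono divide_right_mono add_left_mono mult_left_mono)
    show "variance_upto lam \<delta> D \<le> \<delta>\<^sup>2 * C\<^sub>A\<^sup>2 * N"
      unfolding N_def using assms by (intro full_variance_le) auto
    show "0 \<le> (3 / N + N * (\<integral>\<epsilon>. X \<epsilon> \<partial>noise D)) / 2"
      using N X0 by simp
  qed (use N X0 moment(2) in auto)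
  also have "\<dots> = C\<^sub>A\<^sup>2 * (3 + N\<^sup>2 * exp (K * L - 60 * L\<^sup>2)) / 2 * \<delta>\<^sup>2"
    using N by (simp add: field_simps power2_eq_square)
  also have "\<dots> \<le> C\<^sub>A\<^sup>2 * (3 + exp ((K + 4 * p + 2)\<^sup>2 / 240)) / 2 * \<delta>\<^sup>2"
  proof (intro mult_right_mono divide_right_mono mult_left_mono add_left_mono)
    have "N = exp ((2 * p + 1) * L)" using assms by (simp add: N_def L_def powr_def)
    then have "N\<^sup>2 * exp (K * L - 60 * L\<^sup>2) = exp ((K + 4 * p + 2) * L - 60 * L\<^sup>2)"
      by (simp add: power2_eq_square exp_add[symmetric] algebra_simps)
    also have "\<dots> \<le> exp ((K + 4 * p + 2)\<^sup>2 / 240)"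
    proof -
      \<comment> \<open>The quadratic \<open>a * L - 60 * L\<^sup>2\<close> is largest at
        \<open>L = a / 120\<close>.\<close>
      have "0 \<le> (K + 4 * p + 2 - 120 * L)\<^sup>2" by simp
      then show ?thesis by (simp add: power2_eq_square algebra_simps)
    qed
    finally show "N\<^sup>2 * exp (K * L - 60 * L\<^sup>2) \<le> exp ((K + 4 * p + 2)\<^sup>2 / 240)" .
  qed auto
  finally show "(\<integral>\<epsilon>. g \<epsilon> \<partial>noise D) \<le> C\<^sub>A\<^sup>2 * (3 + exp ((K + 4 * p + 2)\<^sup>2 / 240)) / 2 * \<delta>\<^sup>2" .
qed

text \<open>
  From the index \<open>n\<close> on the procedure should have stopped; just before it the
  signal is still visible in the residual.
\<close>
lemma first_small_weak_bias:
  assumes "m0 \<le> D" "0 \<le> (c::real)"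
  obtains n where "m0 \<le> n" "n \<le> D" "sq_bias D a n \<le> real n * c / 4"
    "m0 < n \<Longrightarrow> real (n - 1) * c / 4 < sq_bias D a (n - 1)"
proof -
  define P where "P n \<longleftrightarrow> m0 \<le> n \<and> sq_bias D a n \<le> real n * c / 4" for n
  define n where "n = (LEAST n. P n)"
  have PD: "P D" using assms by (simp add: P_def sq_bias_def)
  have n: "P n" "n \<le> D" unfolding n_def using PD by (auto intro: LeastI Least_le)
  have "\<not> P (n - 1)" if "m0 < n"
    using that not_less_Least[of "n - 1" P] by (simp add: n_def[symmetric])
  with n that[of n] show ?thesis unfolding P_def by force
qed

text \<open>
  Just before \<open>n\<close> the weak bias exceeds a multiple of
  \<open>n * \<delta>\<^sup>2\<close>. Dividing by \<open>(lam n)\<^sup>2\<close>, the strong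
  bias there exceeds a multiple of the variance at \<open>n\<close>. So the variance at
  \<open>n\<close> is dominated by the bias of each index before \<open>n\<close>, and by the
  variance of each index from \<open>n\<close> on.
\<close>
lemma unstable_variance_le:
  assumes "1 \<le> m0" "m0 < n" "n \<le> D" "M \<le> D" "\<delta> > 0"
    and weak: "real (n - 1) * \<delta>\<^sup>2 / 4 < sq_bias D (\<lambda>i. lam i * \<mu> i) (n - 1)"
    and pos: "\<forall>i\<in>{1..D}. lam i > 0"
    and dec: "\<forall>i\<in>{1..D}. \<forall>j\<in>{1..D}. i \<le> j \<longrightarrow> lam j \<le> lam i"
  shows "variance_upto lam \<delta> n \<le> 8 * (variance_upto lam \<delta> M + sq_bias D \<mu> M)"
proof (cases "n \<le> M")
  case True
  have "variance_upto lam \<delta> n \<le> variance_upto lam \<delta> M" by (rule variance_upto_mono[OF True])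
  then show ?thesis
    using variance_upto_nonneg[of lam \<delta> M] sq_bias_nonneg[of D \<mu> M] unfolding distrib_left by linarith
next
  case False
  have n: "n \<in> {1..D}" using assms by auto
  then have ln: "0 < lam n" using pos by blast
  have "sq_bias D (\<lambda>i. lam i * \<mu> i) (n - 1) \<le> (lam n)\<^sup>2 * sq_bias D \<mu> (n - 1)"
    unfolding sq_bias_def sum_distrib_left
  proof (intro sum_mono)
    fix i assume "i \<in> {n - 1 + 1..D}"
    then have "i \<in> {1..D}" "n \<le> i" using n by auto
    then have "0 < lam i" "lam i \<le> lam n" using pos dec n by auto
    then show "(lam i * \<mu> i)\<^sup>2 \<le> (lam n)\<^sup>2 * (\<mu> i)\<^sup>2"
      unfolding power_mult_distrib by (intro mult_right_mono power_mono) auto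
  qed
  also have "\<dots> \<le> (lam n)\<^sup>2 * sq_bias D \<mu> M"
    using False by (intro mult_left_mono sq_bias_antimono) auto
  finally have b: "real (n - 1) * \<delta>\<^sup>2 / 4 \<le> (lam n)\<^sup>2 * sq_bias D \<mu> M" using weak by linarith
  have "(\<delta> / lam i)\<^sup>2 \<le> (\<delta> / lam n)\<^sup>2" if "i \<in> {1..n}" for i
  proof -
    have i: "i \<in> {1..D}" "i \<le> n" using that n by auto
    then have "lam n \<le> lam i" using dec n by blast
    then show ?thesis using ln assms(5) by (intro power_mono divide_left_mono) auto
  qed
  then have "variance_upto lam \<delta> n \<le> (\<Sum>i = 1..n. (\<delta> / lam n)\<^sup>2)"
    unfolding variance_upto_def by (rule sum_mono)
  also have "\<dots> = real n * \<delta>\<^sup>2 / (lam n)\<^sup>2" by (simp add: power_divide)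
  also have "\<dots> \<le> 2 * real (n - 1) * \<delta>\<^sup>2 / (lam n)\<^sup>2"
    using assms(1,2) by (intro divide_right_mono mult_right_mono) auto
  also have "\<dots> \<le> 8 * ((lam n)\<^sup>2 * sq_bias D \<mu> M) / (lam n)\<^sup>2"
    using b by (intro divide_right_mono) (auto simp: mult_ac)
  also have "\<dots> = 8 * sq_bias D \<mu> M" using ln by simp
  finally show ?thesis using variance_upto_nonneg[of lam \<delta> M] unfolding distrib_left by linarith
qed

section \<open>The risk of the two-step estimator\<close>

text \<open>
  The pointwise bound is integrated term by term: \<open>f\<close> is the selected loss on the
  first \<open>m0\<close> coordinates, \<open>e\<close> the noise energy up to the index
  \<open>n\<close>, \<open>g\<close> a majorant of the noise energy on late stopping, and
  \<open>h\<close> a majorant of the bias lost by early stopping.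
\<close>
lemma two_step_risk_le:
  assumes "p \<ge> 0" "C\<^sub>A \<ge> 1" "K \<ge> 0" "C\<^sub>2 \<ge> 0" "D \<ge> 3" "\<delta> > 0" "\<kappa> > 0" "M \<le> D"
    and pos: "\<forall>i\<in>{1..D}. lam i > 0"
    and dec: "\<forall>i\<in>{1..D}. \<forall>j\<in>{1..D}. i \<le> j \<longrightarrow> lam j \<le> lam i"
    and poly: "\<forall>i\<in>{1..D}. inverse C\<^sub>A * real i powr (- p) \<le> lam i \<and> lam i \<le> C\<^sub>A * real i powr (- p)"
    and kappa: "\<bar>\<kappa> - real D * \<delta>\<^sup>2\<bar> \<le> K * sqrt (real D) * \<delta>\<^sup>2"
    and m0: "m0 = start_index D" "m0 \<le> D"
    and sel: "sel \<in> selectors m0"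
    and selector_bound: "\<forall>\<mu>. risk D lam \<delta> (selected_est lam m0 sel) \<mu>
          \<le> C\<^sub>2 * ((MIN m\<in>{0..m0}. risk D lam \<delta> (tsvd lam m) \<mu>) + \<delta>\<^sup>2)"
  shows "risk D lam \<delta> (two_step_est D lam m0 \<kappa> sel) \<mu>
    \<le> (C\<^sub>2 + 9 + C\<^sub>A\<^sup>2 * (3 + exp ((K + 4 * p + 2)\<^sup>2 / 240)) / 2
        + 4 * exp (K + 5) * (C\<^sub>A\<^sup>2 * 2 powr p)\<^sup>2)
      * (risk D lam \<delta> (tsvd lam M) \<mu> + \<delta>\<^sup>2)"
proof -
  interpret prob_space "noise D" by (rule prob_space_noise)
  define A where "A = C\<^sub>A\<^sup>2 * (3 + exp ((K + 4 * p + 2)\<^sup>2 / 240)) / 2"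
  define B where "B = 4 * exp (K + 5) * (C\<^sub>A\<^sup>2 * 2 powr p)\<^sup>2"
  define V where "V = variance_upto lam \<delta>"
  define S where "S = sq_bias D \<mu> M"
  have AB: "A \<ge> 0" "B \<ge> 0" by (auto simp: A_def B_def intro!: add_nonneg_nonneg mult_nonneg_nonneg)
  have VS: "V M \<ge> 0" "S \<ge> 0" by (auto simp: V_def S_def variance_upto_nonneg sq_bias_nonneg)
  have D1: "start_index D \<le> D" using m0 by simp
  note ix = start_index_bounds[OF assms(5) D1, folded m0(1)]
  have m4: "4 \<le> m0" using ix(5) by simp
  obtain n where n: "m0 \<le> n" "n \<le> D" "sq_bias D (\<lambda>i. lam i * \<mu> i) n \<le> real n * \<delta>\<^sup>2 / 4"
    "m0 < n \<Longrightarrow> real (n - 1) * \<delta>\<^sup>2 / 4 < sq_bias D (\<lambda>i. lam i * \<mu> i) (n - 1)"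
    using first_small_weak_bias[OF m0(2), of "\<delta>\<^sup>2" "\<lambda>i. lam i * \<mu> i"] by auto
  obtain g where g: "integrable (noise D) g"
    "\<And>\<epsilon>. noise_energy lam \<delta> \<epsilon> D * of_bool (\<kappa> < residual D n (obs lam \<delta> \<mu> \<epsilon>)) \<le> g \<epsilon>"
    "(\<integral>\<epsilon>. g \<epsilon> \<partial>noise D) \<le> A * \<delta>\<^sup>2"
    by (rule late_stop_energy[where \<mu> = \<mu>,
          OF assms(1,2,6) n(2) assms(5) n(1)[unfolded m0(1)] n(3) kappa poly pos, folded A_def]) (rule that)
  obtain h where h: "integrable (noise D) h"
    "\<And>\<epsilon>. (\<Sum>m = m0..<M. (lam (Suc m) * \<mu> (Suc m))\<^sup>2
        * of_bool (residual D m (obs lam \<delta> \<mu> \<epsilon>) \<le> \<kappa>)) / (lam M)\<^sup>2 \<le> h \<epsilon>"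
    "(\<integral>\<epsilon>. h \<epsilon> \<partial>noise D) \<le> B * V M"
    by (rule early_stop_strong_bias[where \<mu> = \<mu>,
          OF assms(1,2,6,8) ix(4) m4 assms(3) kappa poly pos, folded B_def V_def]) (rule that)
  define f where "f \<epsilon> = (L2_set (\<lambda>i. selected_est lam m0 sel (obs lam \<delta> (truncated m0 \<mu>) \<epsilon>) i
          - truncated m0 \<mu> i) {1..D})\<^sup>2" for \<epsilon>
  have f: "integrable (noise D) f"
    unfolding f_def[abs_def] using m0(2) pos sel by (rule selected_loss_integrable)
  have "(\<integral>\<epsilon>. f \<epsilon> \<partial>noise D) = risk D lam \<delta> (selected_est lam m0 sel) (truncated m0 \<mu>)"
    by (simp add: risk_def f_def)
  also have "\<dots> \<le> C\<^sub>2 * (V M + S + \<delta>\<^sup>2)"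
    unfolding V_def S_def using m0(2) assms(8) pos assms(4) selector_bound
    by (rule selected_risk_truncated)
  finally have f': "(\<integral>\<epsilon>. f \<epsilon> \<partial>noise D) \<le> C\<^sub>2 * (V M + S + \<delta>\<^sup>2)" .
  define e where "e \<epsilon> = (if m0 < n then noise_energy lam \<delta> \<epsilon> n else 0)" for \<epsilon>
  have e: "integrable (noise D) e"
    unfolding e_def[abs_def] using noise_energy_expectation(1)[OF n(2)] by (cases "m0 < n") auto
  have e': "(\<integral>\<epsilon>. e \<epsilon> \<partial>noise D) \<le> 8 * (V M + S)"
  proof (cases "m0 < n")
    case True
    then have "(\<integral>\<epsilon>. e \<epsilon> \<partial>noise D) = V n"
      using noise_energy_expectation(2)[OF n(2)] by (simp add: e_def V_def)
    also have "\<dots> \<le> 8 * (V M + S)"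
      unfolding V_def S_def using ix(5) assms True n pos dec
      by (intro unstable_variance_le[of m0]) auto
    finally show ?thesis .
  next
    case False
    then show ?thesis using VS by (simp add: e_def)
  qed
  have le: "(L2_set (\<lambda>i. two_step_est D lam m0 \<kappa> sel (obs lam \<delta> \<mu> \<epsilon>) i - \<mu> i) {1..D})\<^sup>2
      \<le> f \<epsilon> + e \<epsilon> + g \<epsilon> + (S + h \<epsilon>)" for \<epsilon>
  proof -
    have "(L2_set (\<lambda>i. two_step_est D lam m0 \<kappa> sel (obs lam \<delta> \<mu> \<epsilon>) i - \<mu> i) {1..D})\<^sup>2
      \<le> f \<epsilon> + e \<epsilon> + noise_energy lam \<delta> \<epsilon> D * of_bool (\<kappa> < residual D n (obs lam \<delta> \<mu> \<epsilon>))
      + (S + (\<Sum>m = m0..<M. (lam (Suc m) * \<mu> (Suc m))\<^sup>2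
          * of_bool (residual D m (obs lam \<delta> \<mu> \<epsilon>) \<le> \<kappa>)) / (lam M)\<^sup>2)"
      unfolding f_def e_def S_def
      using two_step_loss_le[OF m0(2) n(1,2) assms(8) less_imp_le[OF assms(7)] sel pos dec refl] .
    also have "\<dots> \<le> f \<epsilon> + e \<epsilon> + g \<epsilon> + (S + h \<epsilon>)"
      by (intro add_mono order_refl g(2) h(2))
    finally show ?thesis .
  qed
  have "risk D lam \<delta> (two_step_est D lam m0 \<kappa> sel) \<mu>
      \<le> (\<integral>\<epsilon>. f \<epsilon> + e \<epsilon> + g \<epsilon> + (S + h \<epsilon>) \<partial>noise D)"
    unfolding risk_def using f e g(1) h(1) order_trans[OF zero_le_power2 le]
    by (intro integral_mono' le) auto
  also have "\<dots> = (\<integral>\<epsilon>. f \<epsilon> \<partial>noise D) + (\<integral>\<epsilon>. e \<epsilon> \<partial>noise D) + (\<integral>\<epsilon>. g \<epsilon> \<partial>noise D)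
      + (S + (\<integral>\<epsilon>. h \<epsilon> \<partial>noise D))"
    using f e g(1) h(1) by (simp add: prob_space)
  also have "\<dots> \<le> C\<^sub>2 * (V M + S + \<delta>\<^sup>2) + 8 * (V M + S) + A * \<delta>\<^sup>2 + (S + B * V M)"
    using f' e' g(3) h(3) by (intro add_mono) auto
  also have "\<dots> \<le> (C\<^sub>2 + 9 + A + B) * (V M + S + \<delta>\<^sup>2)"
    using AB VS assms(4) by (simp add: algebra_simps)
  finally show ?thesis
    unfolding risk_tsvd[OF assms(8) pos] by (simp add: A_def B_def V_def S_def)
qed

theorem proposition4p2:
  fixes p C\<^sub>A C\<^sub>\<kappa> C\<^sub>2 :: real
  assumes "p \<ge> 0" "C\<^sub>A \<ge> 1" "C\<^sub>\<kappa> \<ge> 0" "C\<^sub>2 \<ge> 1"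
  shows "\<exists>C>0. \<forall>(D::nat) (\<delta>::real) (\<kappa>::real) (lam::nat \<Rightarrow> real) (m0::nat) (sel::(nat \<Rightarrow> real) \<Rightarrow> nat).
    D \<ge> 3 \<longrightarrow> \<delta> > 0 \<longrightarrow> \<kappa> > 0 \<longrightarrow>
    (\<forall>i\<in>{1..D}. lam i > 0) \<longrightarrow>
    (\<forall>i\<in>{1..D}. \<forall>j\<in>{1..D}. i \<le> j \<longrightarrow> lam j \<le> lam i) \<longrightarrow>
    (\<forall>i\<in>{1..D}. inverse C\<^sub>A * real i powr (- p) \<le> lam i \<and> lam i \<le> C\<^sub>A * real i powr (- p)) \<longrightarrow>
    \<bar>\<kappa> - real D * \<delta>\<^sup>2\<bar> \<le> C\<^sub>\<kappa> * sqrt (real D) * \<delta>\<^sup>2 \<longrightarrow>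
    m0 = start_index D \<longrightarrow> m0 \<le> D \<longrightarrow>
    sel \<in> selectors m0 \<longrightarrow>
    (\<forall>\<mu>. risk D lam \<delta> (selected_est lam m0 sel) \<mu>
          \<le> C\<^sub>2 * ((MIN m\<in>{0..m0}. risk D lam \<delta> (tsvd lam m) \<mu>) + \<delta>\<^sup>2)) \<longrightarrow>
    (\<forall>\<mu>. risk D lam \<delta> (two_step_est D lam m0 \<kappa> sel) \<mu>
          \<le> C * ((MIN m\<in>{0..D}. risk D lam \<delta> (tsvd lam m) \<mu>) + \<delta>\<^sup>2))"
proof -
  define C where "C = C\<^sub>2 + 9 + C\<^sub>A\<^sup>2 * (3 + exp ((C\<^sub>\<kappa> + 4 * p + 2)\<^sup>2 / 240)) / 2
        + 4 * exp (C\<^sub>\<kappa> + 5) * (C\<^sub>A\<^sup>2 * 2 powr p)\<^sup>2"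
  have "0 \<le> C\<^sub>A\<^sup>2 * (3 + exp ((C\<^sub>\<kappa> + 4 * p + 2)\<^sup>2 / 240)) / 2"
    by (intro divide_nonneg_nonneg mult_nonneg_nonneg add_nonneg_nonneg) auto
  moreover have "0 \<le> 4 * exp (C\<^sub>\<kappa> + 5) * (C\<^sub>A\<^sup>2 * 2 powr p)\<^sup>2" by simp
  ultimately have "C > 0" using assms(4) unfolding C_def by linarith
  show ?thesis
  proof (intro exI[of _ C] conjI allI impI)
    fix D :: nat and \<delta> \<kappa> :: real and lam :: "nat \<Rightarrow> real" and m0 :: nat
      and sel :: "(nat \<Rightarrow> real) \<Rightarrow> nat" and \<mu> :: "nat \<Rightarrow> real"
    assume h: "D \<ge> 3" "\<delta> > 0" "\<kappa> > 0" "\<forall>i\<in>{1..D}. lam i > 0"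
      "\<forall>i\<in>{1..D}. \<forall>j\<in>{1..D}. i \<le> j \<longrightarrow> lam j \<le> lam i"
      "\<forall>i\<in>{1..D}. inverse C\<^sub>A * real i powr (- p) \<le> lam i \<and> lam i \<le> C\<^sub>A * real i powr (- p)"
      "\<bar>\<kappa> - real D * \<delta>\<^sup>2\<bar> \<le> C\<^sub>\<kappa> * sqrt (real D) * \<delta>\<^sup>2"
      "m0 = start_index D" "m0 \<le> D" "sel \<in> selectors m0"
      "\<forall>\<mu>. risk D lam \<delta> (selected_est lam m0 sel) \<mu>
          \<le> C\<^sub>2 * ((MIN m\<in>{0..m0}. risk D lam \<delta> (tsvd lam m) \<mu>) + \<delta>\<^sup>2)"
    have "(MIN m\<in>{0..D}. risk D lam \<delta> (tsvd lam m) \<mu>) \<in> (\<lambda>m. risk D lam \<delta> (tsvd lam m) \<mu>) ` {0..D}"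
      by (intro Min_in) auto
    then obtain M where "M \<in> {0..D}"
      and min: "(MIN m\<in>{0..D}. risk D lam \<delta> (tsvd lam m) \<mu>) = risk D lam \<delta> (tsvd lam M) \<mu>"
      by blast
    then have M: "M \<le> D" by simp
    show "risk D lam \<delta> (two_step_est D lam m0 \<kappa> sel) \<mu>
          \<le> C * ((MIN m\<in>{0..D}. risk D lam \<delta> (tsvd lam m) \<mu>) + \<delta>\<^sup>2)"
      unfolding min C_def using assms h M by (intro two_step_risk_le) auto
  qed fact
qed

end
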